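(* Let $a,b,\sigma\ge 0$, let $\rho,\theta$ be probability measures on $(0,+\infty)$, let $Q=(Q_t)_{t\in\mathbb{R}}$ be a stationary non-negative discharge process with mean $\bar Q>0$, variance $\bar V>0$ and autocorrelation $A_Q(h)=\int_0^{+\infty}e^{-rh}\,\theta(\mathrm{d}r)$ ($h\ge0$), and let $M=(M_t)_{t\in\mathbb{R}}$, $M_t=\int_0^{+\infty}m_t(\mathrm{d}R)$, be the memory process driven by $Q$ with parameters $a,b,\sigma,\rho$ (as defined in the context), in the stationary state, with $\mathbb{V}[M_t]>0$. Then for every lag $h\ge0$ the autocorrelation $A_M(h)=\mathbb{E}\bigl[(M_t-\mathbb{E}[M_t])(M_{t+h}-\mathbb{E}[M_{t+h}])\bigr]/\mathbb{V}[M_t]$ of $M$ is $$A_M(h)=\frac{1}{\mathbb{V}[M_t]}\left(\frac{\sigma^2}{2}\,\mathbb{E}[M_t]\int_0^{+\infty}e^{-Rh}\rho(\mathrm{d}R)+b^2\bar V\bigl(I(h)+J(h)\bigr)\right),$$ where $$I(h)=\int_{R=0}^{R=+\infty}\int_{P=0}^{P=+\infty}\int_{r=0}^{r=+\infty}\frac{RP}{P+R}\left(\frac{1}{P+r}+\frac{1}{R+r}\right)e^{-Ph}\,\theta(\mathrm{d}r)\,\rho(\mathrm{d}R)\,\rho(\mathrm{d}P)$$ and $$J(h)=\int_{R=0}^{R=+\infty}\int_{P=0}^{P=+\infty}\int_{r=0}^{r=+\infty}\frac{RP}{(R+r)(P-r)}\left(e^{-rh}-e^{-Ph}\right)\thet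a(\mathrm{d}r)\,\rho(\mathrm{d}R)\,\rho(\mathrm{d}P).$$
   Context: All processes live on a complete probability space with a filtration; $\mathbb{E}$ and $\mathbb{V}$ denote expectation and variance. Discharge: $Q=(Q_t)_{t\in\mathbb{R}}$ is a real-valued, non-negative, stationary, continuous-time process with $\bar Q=\mathbb{E}[Q_t]>0$, $\bar V=\mathbb{V}[Q_t]>0$, and $\mathbb{E}[(Q_s-\bar Q)(Q_t-\bar Q)]=\bar V A_Q(|s-t|)$, where $A_Q(h)=\int_0^{+\infty}e^{-rh}\theta(\mathrm{d}r)$ for $h\ge0$ and $\theta$ is a probability measure on $(0,+\infty)$. Memory process: let $a,b,\sigma\ge0$ and let $\rho$ be a probability measure on $(0,+\infty)$. The process $m=(m_t(\mathrm{d}R))_{t\in\mathbb{R}}$ is a stationary process with values in the non-negative measures on $(0,+\infty)$ solving $$\mathrm{d}m_t(\mathrm{d}R)=-R\bigl(m_t(\mathrm{d}R)-(a+bQ_t)\rho(\mathrm{d}R)\bigr)\mathrm{d}t+\sigma\sqrt{R}\,B(\mathrm{d}R,\mathrm{d}t),$$ understood in the integrated form $$m_t(\mathrm{d}R)=\int_{s=-\infty}^{s=t}e^{-R(t-s)}\left\{R(a+bQ_s)\rho(\mathrm{d}R)\,\mathrm{d}s+\sigma\sqrt{R}\,B(\mathrm{d}R,\mathrm{d}s)\right\},$$ and the memory process is the total mass $M_t=\int_0^{+\infty}m_t(\mathrm{d}R)$. Here $B$ is the space-time random measure (two-sided in time) formally given by $B(\mathrm{d}R,\mathrm{d}t)=\sqrt{m_t(\mathrm{d}R)}\,\zeta(\mathrm{d}R,\mathrm{d}t)$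 with $\zeta$ a space-time Gaussian white noise independent of $Q$; formally $\mathbb{E}[B(\mathrm{d}R,\mathrm{d}t)B(\mathrm{d}R',\mathrm{d}t')]=\delta(R-R')\delta(t-t')\,\mathbb{E}\bigl[\sqrt{m_t(\mathrm{d}R)m_{t'}(\mathrm{d}R')}\bigr]\mathrm{d}t\,\mathrm{d}t'$. This means: for deterministic $f,g$ on $(0,+\infty)\times\mathbb{R}$ with $\mathbb{E}\bigl[\iint f^2\,m_s(\mathrm{d}R)\mathrm{d}s\bigr]<\infty$ and likewise for $g$, the stochastic integrals have mean zero, satisfy the isometry $$\mathbb{E}\Bigl[\iint f(R,s)B(\mathrm{d}R,\mathrm{d}s)\iint g(R,s)B(\mathrm{d}R,\mathrm{d}s)\Bigr]=\mathbb{E}\Bigl[\iint f(R,s)g(R,s)\,m_s(\mathrm{d}R)\,\mathrm{d}s\Bigr],$$ and are uncorrelated with every square-integrable random variable measurable with respect to $\sigma(Q_u:u\in\mathbb{R})$. Convention: in $J(h)$, when $P=r$ the quotient $\frac{e^{-rh}-e^{-Ph}}{P-r}$ is understood as its limit $h e^{-rh}$. *)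

theory Defs
  imports "HOL-Probability.Probability"
begin

section \<open>Stationary processes, covariance and autocorrelation\<close>

definition strictly_stationary ::
  "'w measure \<Rightarrow> 's measure \<Rightarrow> (real \<Rightarrow> 'w \<Rightarrow> 's) \<Rightarrow> bool" where
  "strictly_stationary M S X \<longleftrightarrow>
     (\<forall>J h. finite J \<longrightarrow>
        distr M (Pi\<^sub>M J (\<lambda>_. S)) (\<lambda>\<omega>. \<lambda>t\<in>J. X (t + h) \<omega>) =
        distr M (Pi\<^sub>M J (\<lambda>_. S)) (\<lambda>\<omega>. \<lambda>t\<in>J. X t \<omega>))"

definition covariance :: "'w measure \<Rightarrow> ('w \<Rightarrow> real) \<Rightarrow> ('w \<Rightarrow> real) \<Rightarrow> real" where
  "covariance M X Y =
     (\<integral>\<omega>. (X \<omega> - (\<integral>\<omega>'. X \<omega>' \<partial>M)) * (Y \<omega> - (\<integral>\<omega>'. Y \<omega>' \<partial>M)) \<partial>M)"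

definition autocorrelation :: "'w measure \<Rightarrow> (real \<Rightarrow> 'w \<Rightarrow> real) \<Rightarrow> real \<Rightarrow> real \<Rightarrow> real" where
  "autocorrelation M X t h = covariance M (X t) (X (t + h)) / prob_space.variance M (X t)"

definition generated_algebra :: "'w measure \<Rightarrow> (real \<Rightarrow> 'w \<Rightarrow> real) \<Rightarrow> 'w measure" where
  "generated_algebra M X = (SUP t. vimage_algebra (space M) (X t) borel)"

section \<open>Random measures on the open half-line\<close>

abbreviation pos_borel :: "real measure" where
  "pos_borel \<equiv> restrict_space borel {0<..}"

text \<open>The measurable space of finite measures on \<open>K\<close>, generated by the evaluation maps;
  this is \<open>subprob_algebra\<close> without the bound on the total mass.\<close>

definition finite_measure_algebra :: "'s measure \<Rightarrow> 's measure measure" where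
  "finite_measure_algebra K =
     (SUP A \<in> sets K.
        vimage_algebra {N. finite_measure N \<and> sets N = sets K} (\<lambda>N. emeasure N A) borel)"

definition memory :: "(real \<Rightarrow> 'w \<Rightarrow> real measure) \<Rightarrow> real \<Rightarrow> 'w \<Rightarrow> real" where
  "memory m t \<omega> = measure (m t \<omega>) {0<..}"

definition admissible ::
  "'w measure \<Rightarrow> (real \<Rightarrow> 'w \<Rightarrow> real measure) \<Rightarrow> (real \<times> real \<Rightarrow> real) \<Rightarrow> bool" where
  "admissible M m f \<longleftrightarrow>
     f \<in> borel_measurable (pos_borel \<Otimes>\<^sub>M borel) \<and>
     (\<integral>\<^sup>+\<omega>. \<integral>\<^sup>+s. \<integral>\<^sup>+R. ennreal ((f (R, s))\<^sup>2) \<partial>m s \<omega> \<partial>lborel \<partial>M) < \<infinity>"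

section \<open>The discharge and the memory process\<close>

locale filtered_prob_space =
  prob_space M + complete_measure M + filtration "space M" F
  for M :: "'w measure" and F :: "real \<Rightarrow> 'w measure" +
  assumes sets_F_subset: "sets (F t) \<subseteq> sets M"

locale discharge = filtered_prob_space M F
  for M :: "'w measure" and F :: "real \<Rightarrow> 'w measure" +
  fixes Q :: "real \<Rightarrow> 'w \<Rightarrow> real" and \<theta> :: "real measure" and Qbar Vbar :: real
  assumes Q_jointly_measurable: "(\<lambda>(t, \<omega>). Q t \<omega>) \<in> borel_measurable (borel \<Otimes>\<^sub>M M)"
    and Q_adapted: "Q t \<in> borel_measurable (F t)"
    and Q_nonneg: "\<omega> \<in> space M \<Longrightarrow> 0 \<le> Q t \<omega>"
    and Q_stationary: "strictly_stationary M borel Q"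
    and Q_mean: "expectation (Q t) = Qbar" and Qbar_pos: "0 < Qbar"
    and Q_variance: "variance (Q t) = Vbar" and Vbar_pos: "0 < Vbar"
    and prob_space_\<theta>: "prob_space \<theta>" and sets_\<theta>: "sets \<theta> = sets pos_borel"
    and Q_covariance: "covariance M (Q s) (Q t) = Vbar * (\<integral>r. exp (- (r * \<bar>s - t\<bar>)) \<partial>\<theta>)"

text \<open>The space-time random measure enters through its integrals of deterministic
  functions: \<open>B f\<close> stands for \<open>\<integral>\<integral> f(R,s) B(dR,ds)\<close>, and is constrained for admissible \<open>f\<close>
  only. Almost sure linearity of \<open>B\<close> follows from the isometry.
  The equation for \<open>m\<close> is evaluated on Borel sets \<open>A\<close>, the exceptional null set being
  allowed to depend on \<open>t\<close> and \<open>A\<close>.\<close>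

locale memory_process = discharge M F Q \<theta> Qbar Vbar
  for M :: "'w measure" and F :: "real \<Rightarrow> 'w measure"
    and Q :: "real \<Rightarrow> 'w \<Rightarrow> real" and \<theta> :: "real measure" and Qbar Vbar :: real +
  fixes a b \<sigma> :: real and \<rho> :: "real measure"
    and m :: "real \<Rightarrow> 'w \<Rightarrow> real measure"
    and B :: "(real \<times> real \<Rightarrow> real) \<Rightarrow> 'w \<Rightarrow> real"
  assumes a_nonneg: "0 \<le> a" and b_nonneg: "0 \<le> b" and \<sigma>_nonneg: "0 \<le> \<sigma>"
    and prob_space_\<rho>: "prob_space \<rho>" and sets_\<rho>: "sets \<rho> = sets pos_borel"
    and m_jointly_measurable:
      "(\<lambda>(t, \<omega>). m t \<omega>) \<in> borel \<Otimes>\<^sub>M M \<rightarrow>\<^sub>M finite_measure_algebra pos_borel"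
    and m_adapted: "m t \<in> F t \<rightarrow>\<^sub>M finite_measure_algebra pos_borel"
    and m_stationary: "strictly_stationary M (finite_measure_algebra pos_borel) m"
    and B_measurable: "admissible M m f \<Longrightarrow> B f \<in> borel_measurable M"
    and B_square_integrable: "admissible M m f \<Longrightarrow> integrable M (\<lambda>\<omega>. (B f \<omega>)\<^sup>2)"
    and B_mean: "admissible M m f \<Longrightarrow> expectation (B f) = 0"
    and B_isometry:
      "admissible M m f \<Longrightarrow> admissible M m g \<Longrightarrow>
         expectation (\<lambda>\<omega>. B f \<omega> * B g \<omega>) =
         expectation (\<lambda>\<omega>. \<integral>s. (\<integral>R. f (R, s) * g (R, s) \<partial>m s \<omega>) \<partial>lborel)"
    and B_uncorrelated:
      "admissible M m f \<Longrightarrow> Y \<in> borel_measurable (generated_algebra M Q) \<Longrightarrow>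
         integrable M (\<lambda>\<omega>. (Y \<omega>)\<^sup>2) \<Longrightarrow> covariance M (B f) Y = 0"
    and m_equation:
      "A \<in> sets pos_borel \<Longrightarrow>
         AE \<omega> in M. measure (m t \<omega>) A =
           (\<integral>(R, s). indicator A R * indicator {..t} s * exp (- R * (t - s)) *
                      (R * (a + b * Q s \<omega>)) \<partial>(\<rho> \<Otimes>\<^sub>M lborel)) +
           B (\<lambda>(R, s). indicator A R * indicator {..t} s * exp (- R * (t - s)) *
                      (\<sigma> * sqrt R)) \<omega>"

section \<open>The integrals in the autocorrelation of the memory process\<close>

definition I_integral :: "real measure \<Rightarrow> real measure \<Rightarrow> real \<Rightarrow> real" where
  "I_integral \<rho> \<theta> h =
     (\<integral>R. (\<integral>P. (\<integral>r. R * P / (P + R) * (1 / (P + r) + 1 / (R + r)) * exp (- P * h)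
        \<partial>\<theta>) \<partial>\<rho>) \<partial>\<rho>)"

text \<open>The quotient \<open>(e\<^sup>-\<^sup>r\<^sup>h - e\<^sup>-\<^sup>P\<^sup>h) / (P - r)\<close>, extended by its limit at \<open>P = r\<close>.\<close>

definition exp_quotient :: "real \<Rightarrow> real \<Rightarrow> real \<Rightarrow> real" where
  "exp_quotient h P r =
     (if P = r then h * exp (- r * h) else (exp (- r * h) - exp (- P * h)) / (P - r))"

definition J_integral :: "real measure \<Rightarrow> real measure \<Rightarrow> real \<Rightarrow> real" where
  "J_integral \<rho> \<theta> h =
     (\<integral>R. (\<integral>P. (\<integral>r. R * P / (R + r) * exp_quotient h P r \<partial>\<theta>) \<partial>\<rho>) \<partial>\<rho>)"

end

theory Submission
  imports Defs
begin

text \<open>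
  Evaluating the integrated equation on the whole half-line splits the memory process, for each
  time, into \<open>M\<^sub>t = X\<^sub>t + Y\<^sub>t\<close> almost surely: the drift \<open>X\<^sub>t\<close> is a weighted average of
  \<open>a + b Q\<^sub>s\<close> over the past and over the rates \<open>R\<close>, and \<open>Y\<^sub>t\<close> is the integral of a deterministic
  kernel against the noise \<open>B\<close>. Three observations turn this into the covariance formula.

  The weights \<open>R exp (- R (t - s))\<close> on \<open>s \<le> t\<close> integrate to one in \<open>s\<close>, so with \<open>\<rho>\<close> they
  form a probability measure on pairs \<open>(R, s)\<close> (\<open>prob_space_memory_law\<close>) and \<open>X\<^sub>t\<close> is an average of
  an \<open>L\<^sup>2\<close>-bounded family of random variables. Covariances commute with such averages
  (\<open>covariance_average\<close>). Hence the covariance of \<open>X\<^sub>t\<close> and \<open>X\<^sub>t\<^sub>+\<^sub>h\<close> is \<open>b\<^sup>2 Vbar\<close> times the average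
  of \<open>exp (- r \<bar>s - v\<bar>)\<close> over two such laws and \<open>\<theta>\<close>; Tonelli and an elementary double integral of
  exponentials identify it with \<open>I + J\<close> (\<open>memory_law_exp_correlation\<close>). The same principle
  shows that \<open>Y\<close> is uncorrelated with \<open>X\<close>, because it is uncorrelated with every single \<open>Q\<^sub>s\<close>:
  measurability for the \<open>\<sigma>\<close>-algebra generated by \<open>Q\<close> is evident for \<open>Q\<^sub>s\<close>, but not for the integral \<open>X\<^sub>t\<close>
  of a path.

  The kernel of the noise contains the unbounded factor \<open>\<surd>R\<close>, so its admissibility has to
  be proved before the isometry can be used. By stationarity the expectation of \<open>m\<^sub>s\<close> is the same
  for all \<open>s\<close> (\<open>nn_integral_space_time_stationary\<close>), so the time integral can be carried out
  first; it turns \<open>R exp (- 2 R (t - s))\<close> into \<open>1/2\<close> and leaves a multiple of the expected mass,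
  which is finite because a positive variance (a Bochner integral, hence zero when it diverges)
  forces \<open>M\<^sub>t\<close> to be square integrable.

  Once the noise integrals are known to have mean zero, the equation gives the intensity
  \<open>E m\<^sub>t(A) = (a + b Qbar) \<rho>(A)\<close>; inserting it in the isometry yields the covariance of \<open>Y\<^sub>t\<close> and
  \<open>Y\<^sub>t\<^sub>+\<^sub>h\<close>, the term with \<open>\<sigma>\<^sup>2 / 2\<close>.
\<close>

section \<open>Square-integrable random variables and their covariances\<close>

definition square_integrable :: "'w measure \<Rightarrow> ('w \<Rightarrow> real) \<Rightarrow> bool" where
  "square_integrable M X \<longleftrightarrow> X \<in> borel_measurable M \<and> integrable M (\<lambda>\<omega>. (X \<omega>)\<^sup>2)"

lemma square_integrable_measurable: "square_integrable M X \<Longrightarrow> X \<in> borel_measurable M"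
  by (simp add: square_integrable_def)

lemma square_integrable_mult:
  assumes "square_integrable M X" "square_integrable M Y"
  shows "integrable M (\<lambda>\<omega>. X \<omega> * Y \<omega>)"
proof (rule Bochner_Integration.integrable_bound[where f="\<lambda>\<omega>. (X \<omega>)\<^sup>2 + (Y \<omega>)\<^sup>2"])
  have "\<bar>x * y\<bar> \<le> x\<^sup>2 + y\<^sup>2" for x y :: real
  proof -
    have "0 \<le> \<bar>x\<bar> * \<bar>y\<bar>" "2 * (\<bar>x\<bar> * \<bar>y\<bar>) \<le> x\<^sup>2 + y\<^sup>2"
      using sum_squares_bound[of "\<bar>x\<bar>" "\<bar>y\<bar>"] by auto
    then show ?thesis
      by (simp only: abs_mult)
  qed
  then show "AE \<omega> in M. norm (X \<omega> * Y \<omega>) \<le> norm ((X \<omega>)\<^sup>2 + (Y \<omega>)\<^sup>2)"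
    by auto
qed (use assms in \<open>auto simp: square_integrable_def\<close>)

lemma square_integrable_cmult: "square_integrable M X \<Longrightarrow> square_integrable M (\<lambda>\<omega>. c * X \<omega>)"
  by (auto simp: square_integrable_def power_mult_distrib)

lemma square_integrable_add:
  assumes "square_integrable M X" "square_integrable M Y"
  shows "square_integrable M (\<lambda>\<omega>. X \<omega> + Y \<omega>)"
  using assms square_integrable_mult[OF assms]
  by (auto simp: square_integrable_def power2_sum mult.assoc)

context prob_space
begin

lemma square_integrable_const: "square_integrable M (\<lambda>_. c)"
  by (simp add: square_integrable_def)

lemma integrable_if_square_integrable: "square_integrable M X \<Longrightarrow> integrable M X"
  unfolding square_integrable_def by (blast intro: square_integrable_imp_integrable)

text \<open>The variance is a Bochner integral, with value zero when the square is not integrable.\<close>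

lemma square_integrable_if_variance_pos:
  assumes X: "X \<in> borel_measurable M" and "0 < variance X"
  shows "square_integrable M X"
proof -
  have "integrable M (\<lambda>\<omega>. (X \<omega> - expectation X)\<^sup>2)"
    using assms(2) not_integrable_integral_eq by fastforce
  then have "square_integrable M (\<lambda>\<omega>. X \<omega> - expectation X)"
    using X by (simp add: square_integrable_def)
  from square_integrable_add[OF this square_integrable_const[of "expectation X"]] show ?thesis
    by simp
qed

lemma covariance_eq:
  assumes "square_integrable M X" "square_integrable M Y"
  shows "covariance M X Y = expectation (\<lambda>\<omega>. X \<omega> * Y \<omega>) - expectation X * expectation Y"
proof -
  note int = square_integrable_mult[OF assms]
    assms(1)[THEN integrable_if_square_integrable] assms(2)[THEN integrable_if_square_integrable]
  show ?thesis
    using int by (simp add: covariance_def algebra_simps prob_space)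
qed

lemma covariance_commute: "covariance M X Y = covariance M Y X"
  by (simp add: covariance_def mult.commute)

lemma covariance_add_left:
  assumes X: "square_integrable M X" and X': "square_integrable M X'" and Y: "square_integrable M Y"
  shows "covariance M (\<lambda>\<omega>. X \<omega> + X' \<omega>) Y = covariance M X Y + covariance M X' Y"
  using square_integrable_mult[OF X Y] square_integrable_mult[OF X' Y]
    X[THEN integrable_if_square_integrable] X'[THEN integrable_if_square_integrable]
  by (simp add: covariance_eq square_integrable_add X X' Y distrib_right)

lemma covariance_affine_left:
  assumes X: "square_integrable M X"
  shows "covariance M (\<lambda>\<omega>. a + b * X \<omega>) Y = b * covariance M X Y"
  using integrable_if_square_integrable[OF X]
  by (simp add: covariance_def prob_space mult.assoc flip: right_diff_distrib)

lemma covariance_cong_AE: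
  assumes "AE \<omega> in M. X \<omega> = X' \<omega>" "AE \<omega> in M. Y \<omega> = Y' \<omega>"
    and [measurable]: "X \<in> borel_measurable M" "X' \<in> borel_measurable M"
      "Y \<in> borel_measurable M" "Y' \<in> borel_measurable M"
  shows "covariance M X Y = covariance M X' Y'"
proof -
  have "expectation X = expectation X'" "expectation Y = expectation Y'"
    using assms by (auto intro!: integral_cong_AE)
  then show ?thesis
    unfolding covariance_def using assms(1,2) by (intro integral_cong_AE) auto
qed

end

text \<open>The average \<open>\<integral>p. U p \<omega> \<partial>N\<close> of a family of random variables over a probability measure \<open>N\<close> of
  parameters. Square integrability for the product measure makes all uses of Fubini legitimate.\<close>

locale averaged_process = prob_space M + N: prob_space N
  for M :: "'w measure" and N :: "'p measure" +
  fixes U :: "'p \<Rightarrow> 'w \<Rightarrow> real"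
  assumes joint: "square_integrable (N \<Otimes>\<^sub>M M) (\<lambda>(p, \<omega>). U p \<omega>)"
begin

sublocale P: pair_prob_space N M ..

lemma U_joint_measurable[measurable]: "(\<lambda>(p, \<omega>). U p \<omega>) \<in> borel_measurable (N \<Otimes>\<^sub>M M)"
  using joint by (rule square_integrable_measurable)

lemma square_integrable_product:
  assumes Z: "square_integrable M Z"
  shows "square_integrable (N \<Otimes>\<^sub>M M) (\<lambda>(p, \<omega>). Z \<omega>)"
proof -
  have Z_meas[measurable]: "Z \<in> borel_measurable M"
    using Z by (rule square_integrable_measurable)
  have "(\<integral>\<^sup>+q. ennreal ((Z (snd q))\<^sup>2) \<partial>(N \<Otimes>\<^sub>M M)) = (\<integral>\<^sup>+\<omega>. ennreal ((Z \<omega>)\<^sup>2) \<partial>M)"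
    by (subst nn_integral_fst[symmetric]) (auto simp: N.emeasure_space_1)
  also have "\<dots> < \<infinity>"
    using Z by (simp add: square_integrable_def integrable_iff_bounded)
  finally show ?thesis
    by (auto simp: square_integrable_def case_prod_unfold integrable_iff_bounded)
qed

lemma section_square_integrable: "AE p in N. square_integrable M (U p)"
proof -
  have "AE p in N. integrable M (\<lambda>\<omega>. (U p \<omega>)\<^sup>2)"
    using joint P.AE_integrable_fst[of "\<lambda>p \<omega>. (U p \<omega>)\<^sup>2"]
    by (simp add: square_integrable_def case_prod_unfold)
  then show ?thesis
    using AE_space by eventually_elim (auto simp: square_integrable_def)
qed

text \<open>Pathwise, the square of the average is at most the average of the square, since the variance
  with respect to \<open>N\<close> is non-negative.\<close>

lemma average_square_integrable: "square_integrable M (\<lambda>\<omega>. \<integral>p. U p \<omega> \<partial>N)"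
proof -
  have sq: "integrable (N \<Otimes>\<^sub>M M) (\<lambda>(p, \<omega>). (U p \<omega>)\<^sup>2)"
    using joint by (simp add: square_integrable_def case_prod_unfold)
  have "AE \<omega> in M. integrable N (\<lambda>p. (U p \<omega>)\<^sup>2)"
    using P.AE_integrable_snd[OF sq] .
  then have "AE \<omega> in M. (\<integral>p. U p \<omega> \<partial>N)\<^sup>2 \<le> (\<integral>p. (U p \<omega>)\<^sup>2 \<partial>N)"
    using AE_space
  proof eventually_elim
    case (elim \<omega>)
    then have "square_integrable N (\<lambda>p. U p \<omega>)"
      by (auto simp: square_integrable_def)
    then have "integrable N (\<lambda>p. U p \<omega>)"
      by (rule N.integrable_if_square_integrable)
    then show ?case
      using N.variance_eq[of "\<lambda>p. U p \<omega>"] elim N.variance_positive[of "\<lambda>p. U p \<omega>"] by simp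
  qed
  then have "integrable M (\<lambda>\<omega>. (\<integral>p. U p \<omega> \<partial>N)\<^sup>2)"
    by (intro Bochner_Integration.integrable_bound[OF P.integrable_snd[OF sq]]) auto
  then show ?thesis
    by (simp add: square_integrable_def)
qed

lemma
  assumes Z: "square_integrable M Z"
  shows expectation_mult_average:
      "expectation (\<lambda>\<omega>. Z \<omega> * (\<integral>p. U p \<omega> \<partial>N)) = (\<integral>p. expectation (\<lambda>\<omega>. Z \<omega> * U p \<omega>) \<partial>N)"
    and integrable_expectation_mult: "integrable N (\<lambda>p. expectation (\<lambda>\<omega>. Z \<omega> * U p \<omega>))"
proof -
  have ZU: "integrable (N \<Otimes>\<^sub>M M) (\<lambda>(p, \<omega>). Z \<omega> * U p \<omega>)"
    using square_integrable_mult[OF square_integrable_product[OF Z] joint] by (simp add: case_prod_unfold)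
  show "integrable N (\<lambda>p. expectation (\<lambda>\<omega>. Z \<omega> * U p \<omega>))"
    using P.integrable_fst[OF ZU] .
  show "expectation (\<lambda>\<omega>. Z \<omega> * (\<integral>p. U p \<omega> \<partial>N)) = (\<integral>p. expectation (\<lambda>\<omega>. Z \<omega> * U p \<omega>) \<partial>N)"
    using P.Fubini_integral[OF ZU] by simp
qed

lemma expectation_average: "expectation (\<lambda>\<omega>. \<integral>p. U p \<omega> \<partial>N) = (\<integral>p. expectation (U p) \<partial>N)"
  using expectation_mult_average[OF square_integrable_const[of 1]] by simp

text \<open>Fubini, for \<open>Z U\<close> and for \<open>U\<close>. In particular a random variable that is uncorrelated with every
  member of the family is uncorrelated with its average.\<close>

lemma covariance_average:
  assumes Z: "square_integrable M Z"
  shows "covariance M Z (\<lambda>\<omega>. \<integral>p. U p \<omega> \<partial>N) = (\<integral>p. covariance M Z (U p) \<partial>N)"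
proof -
  have int: "integrable N (\<lambda>p. expectation (U p))"
    using integrable_expectation_mult[OF square_integrable_const[of 1]] by simp
  have "covariance M Z (\<lambda>\<omega>. \<integral>p. U p \<omega> \<partial>N) =
      (\<integral>p. expectation (\<lambda>\<omega>. Z \<omega> * U p \<omega>) - expectation Z * expectation (U p) \<partial>N)"
    using int integrable_expectation_mult[OF Z]
    by (simp add: covariance_eq[OF Z average_square_integrable] expectation_mult_average[OF Z] expectation_average)
  also have "\<dots> = (\<integral>p. covariance M Z (U p) \<partial>N)"
  proof (rule integral_cong_AE)
    have [measurable]: "Z \<in> borel_measurable M"
      using Z by (rule square_integrable_measurable)
    show "AE p in N. expectation (\<lambda>\<omega>. Z \<omega> * U p \<omega>) - expectation Z * expectation (U p) = covariance M Z (U p)"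
      using section_square_integrable by eventually_elim (simp add: covariance_eq[OF Z])
    show "(\<lambda>p. covariance M Z (U p)) \<in> borel_measurable N"
      unfolding covariance_def by measurable
  qed (use int integrable_expectation_mult[OF Z] in auto)
  finally show ?thesis .
qed

end

section \<open>Random finite measures\<close>

lemma space_finite_measure_algebra:
  "space (finite_measure_algebra K) = {N. finite_measure N \<and> sets N = sets K}"
  by (auto simp: finite_measure_algebra_def space_Sup_eq_UN)

lemma measurable_emeasure_finite_measure_algebra:
  assumes "A \<in> sets K"
  shows "(\<lambda>N. emeasure N A) \<in> borel_measurable (finite_measure_algebra K)"
  unfolding finite_measure_algebra_def
  by (rule measurable_SUP1[OF assms]) (auto intro!: measurable_vimage_algebra1)

lemma
  assumes "L \<in> M \<rightarrow>\<^sub>M finite_measure_algebra N" and "x \<in> space M"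
  shows finite_measure_kernel: "finite_measure (L x)"
    and sets_finite_kernel: "sets (L x) = sets N"
    and space_finite_kernel: "space (L x) = space N"
proof -
  have "L x \<in> space (finite_measure_algebra N)"
    using assms by (rule measurable_space)
  then show "finite_measure (L x)" "sets (L x) = sets N" "space (L x) = space N"
    by (auto simp: space_finite_measure_algebra dest: sets_eq_imp_space_eq)
qed

text \<open>After division by one plus the total mass, a kernel of finite measures becomes a kernel of
  subprobability measures, for which the Giry monad provides the measurability.\<close>

lemma nn_integral_measurable_finite_kernel:
  assumes f: "(\<lambda>(x, y). f x y) \<in> borel_measurable (M \<Otimes>\<^sub>M N)"
    and L: "L \<in> M \<rightarrow>\<^sub>M finite_measure_algebra N"
  shows "(\<lambda>x. integral\<^sup>N (L x) (f x)) \<in> borel_measurable M"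
proof (cases "space N = {}")
  case True
  then have "integral\<^sup>N (L x) (f x) = 0" if "x \<in> space M" for x
    using space_finite_kernel[OF L that] by (simp add: nn_integral_empty)
  then show ?thesis
    by (simp cong: measurable_cong)
next
  case False
  (* Adding one keeps the normalising factor away from zero. *)
  define c where "c x = 1 + emeasure (L x) (space N)" for x
  define S where "S x = scale_measure (inverse (c x)) (L x)" for x
  have emeasure_meas[measurable]: "(\<lambda>x. emeasure (L x) A) \<in> borel_measurable M" if "A \<in> sets N" for A
    using measurable_compose[OF L measurable_emeasure_finite_measure_algebra[OF that]] .
  have c_meas[measurable]: "c \<in> borel_measurable M"
    unfolding c_def by measurable
  have fin: "emeasure (L x) (space N) < top" if "x \<in> space M" for x
    using finite_measure.emeasure_finite[OF finite_measure_kernel[OF L that], of "space N"]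
    by (simp add: less_top)
  have c: "c x \<noteq> 0" "c x < top" if "x \<in> space M" for x
    using fin[OF that] by (auto simp: c_def)
  have "S \<in> M \<rightarrow>\<^sub>M subprob_algebra N"
  proof (rule measurable_subprob_algebra)
    fix x assume x: "x \<in> space M"
    have "inverse (c x) * emeasure (L x) (space N) \<le> inverse (c x) * c x"
      by (intro mult_left_mono) (auto simp: c_def)
    also have "\<dots> = 1"
      using c[OF x] by (metis ennreal_divide_self divide_ennreal_def mult.commute less_top)
    finally have "emeasure (S x) (space (S x)) \<le> 1"
      using x by (simp add: S_def space_scale_measure space_finite_kernel[OF L])
    then show "subprob_space (S x)"
      using x False by (intro subprob_spaceI) (auto simp: S_def space_scale_measure space_finite_kernel[OF L])
    show "sets (S x) = sets N"
      using x by (simp add: S_def sets_finite_kernel[OF L])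
  qed (simp add: S_def)
  then have "(\<lambda>x. c x * integral\<^sup>N (S x) (f x)) \<in> borel_measurable M"
    using f by (intro borel_measurable_times_ennreal nn_integral_measurable_subprob_algebra2[where N=N]) auto
  moreover have "c x * integral\<^sup>N (S x) (f x) = integral\<^sup>N (L x) (f x)" if x: "x \<in> space M" for x
  proof -
    have "f x \<in> borel_measurable (L x)"
      using measurable_Pair2[OF f x] by (simp add: measurable_cong_sets[OF sets_finite_kernel[OF L x] refl])
    then have "c x * integral\<^sup>N (S x) (f x) = (inverse (c x) * c x) * integral\<^sup>N (L x) (f x)"
      by (simp add: S_def nn_integral_scale_measure mult_ac)
    also have "inverse (c x) * c x = 1"
      using c[OF x] by (metis ennreal_divide_self divide_ennreal_def mult.commute less_top)
    finally show ?thesis by simp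
  qed
  ultimately show ?thesis
    by (simp cong: measurable_cong)
qed

lemma strictly_stationary_distr_eq:
  assumes X: "strictly_stationary M S X" and meas: "\<And>t. X t \<in> M \<rightarrow>\<^sub>M S"
  shows "distr M S (X s) = distr M S (X t)"
proof -
  have marginal: "distr (distr M (Pi\<^sub>M {t} (\<lambda>_. S)) (\<lambda>\<omega>. \<lambda>u\<in>{t}. X (u + h) \<omega>)) S (\<lambda>f. f t) =
      distr M S (X (t + h))" for h
    using meas by (subst distr_distr) (auto simp: comp_def intro!: measurable_restrict)
  show ?thesis
    using X[unfolded strictly_stationary_def, rule_format, of "{t}" "s - t"] marginal[of "s - t"] marginal[of 0]
    by simp
qed

text \<open>Both sides are the integral of \<open>N \<mapsto> \<integral> g dN\<close> over the common law of \<open>X s\<close> and \<open>X t\<close>.\<close>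

lemma nn_integral_stationary_kernel:
  assumes X: "strictly_stationary M (finite_measure_algebra K) X"
    and meas: "\<And>t. X t \<in> M \<rightarrow>\<^sub>M finite_measure_algebra K"
    and g: "g \<in> borel_measurable K"
  shows "(\<integral>\<^sup>+\<omega>. \<integral>\<^sup>+x. g x \<partial>X s \<omega> \<partial>M) = (\<integral>\<^sup>+\<omega>. \<integral>\<^sup>+x. g x \<partial>X t \<omega> \<partial>M)"
proof -
  let ?A = "finite_measure_algebra K"
  have G: "(\<lambda>N. integral\<^sup>N N g) \<in> borel_measurable ?A"
    using g by (intro nn_integral_measurable_finite_kernel[where N=K and L="\<lambda>N. N"]) auto
  have "(\<integral>\<^sup>+\<omega>. integral\<^sup>N (X u \<omega>) g \<partial>M) = (\<integral>\<^sup>+N. integral\<^sup>N N g \<partial>distr M ?A (X u))" for u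
    by (rule nn_integral_distr[OF meas, symmetric]) (simp add: G)
  then show ?thesis
    using strictly_stationary_distr_eq[OF X meas, of s t] by simp
qed

text \<open>In expectation the moving measure \<open>X s\<close> may be replaced by the measure \<open>X t\<close> at a fixed time.
  This decouples the two integrals, so that the time integral can be computed first.\<close>

lemma nn_integral_space_time_stationary:
  fixes X :: "real \<Rightarrow> 'w \<Rightarrow> 's measure"
  assumes "prob_space M"
    and X: "strictly_stationary M (finite_measure_algebra K) X"
    and joint: "(\<lambda>(t, \<omega>). X t \<omega>) \<in> borel \<Otimes>\<^sub>M M \<rightarrow>\<^sub>M finite_measure_algebra K"
    and g: "g \<in> borel_measurable (K \<Otimes>\<^sub>M borel)"
  shows "(\<integral>\<^sup>+\<omega>. \<integral>\<^sup>+s. \<integral>\<^sup>+x. g (x, s) \<partial>X s \<omega> \<partial>lborel \<partial>M) =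
    (\<integral>\<^sup>+\<omega>. \<integral>\<^sup>+x. \<integral>\<^sup>+s. g (x, s) \<partial>lborel \<partial>X t \<omega> \<partial>M)"
proof -
  interpret prob_space M by fact
  interpret P: pair_sigma_finite lborel M ..
  have meas: "X u \<in> M \<rightarrow>\<^sub>M finite_measure_algebra K" for u
    using measurable_Pair2[OF joint, of u] by simp
  have g_swap: "(\<lambda>(s, x). g (x, s)) \<in> borel_measurable (lborel \<Otimes>\<^sub>M K)"
    using measurable_pair_swap[OF g] by simp
  have g_fst: "(\<lambda>(p, x). g (x, fst p)) \<in> borel_measurable ((borel \<Otimes>\<^sub>M M) \<Otimes>\<^sub>M K)"
    using g by measurable
  have "(\<lambda>p. \<integral>\<^sup>+x. g (x, fst p) \<partial>(case p of (t, \<omega>) \<Rightarrow> X t \<omega>)) \<in> borel_measurable (borel \<Otimes>\<^sub>M M)"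
    by (rule nn_integral_measurable_finite_kernel[OF g_fst joint])
  then have inner: "(\<lambda>(s, \<omega>). \<integral>\<^sup>+x. g (x, s) \<partial>X s \<omega>) \<in> borel_measurable (lborel \<Otimes>\<^sub>M M)"
    by (simp add: case_prod_unfold)
  have "(\<integral>\<^sup>+\<omega>. \<integral>\<^sup>+s. \<integral>\<^sup>+x. g (x, s) \<partial>X s \<omega> \<partial>lborel \<partial>M) =
      (\<integral>\<^sup>+s. \<integral>\<^sup>+\<omega>. \<integral>\<^sup>+x. g (x, s) \<partial>X s \<omega> \<partial>M \<partial>lborel)"
    using P.Fubini'[OF inner] by simp
  also have "\<dots> = (\<integral>\<^sup>+s. \<integral>\<^sup>+\<omega>. \<integral>\<^sup>+x. g (x, s) \<partial>X t \<omega> \<partial>M \<partial>lborel)"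
    using measurable_Pair1[OF g] by (intro nn_integral_cong nn_integral_stationary_kernel[OF X meas]) auto
  also have "\<dots> = (\<integral>\<^sup>+\<omega>. \<integral>\<^sup>+s. \<integral>\<^sup>+x. g (x, s) \<partial>X t \<omega> \<partial>lborel \<partial>M)"
  proof (rule P.Fubini'[symmetric])
    have "(\<lambda>p. \<integral>\<^sup>+x. g (x, fst p) \<partial>X t (snd p)) \<in> borel_measurable (borel \<Otimes>\<^sub>M M)"
      by (rule nn_integral_measurable_finite_kernel[OF g_fst measurable_compose[OF measurable_snd meas]])
    then show "(\<lambda>(s, \<omega>). \<integral>\<^sup>+x. g (x, s) \<partial>X t \<omega>) \<in> borel_measurable (lborel \<Otimes>\<^sub>M M)"
      by (simp add: case_prod_unfold)
  qed
  also have "\<dots> = (\<integral>\<^sup>+\<omega>. \<integral>\<^sup>+x. \<integral>\<^sup>+s. g (x, s) \<partial>lborel \<partial>X t \<omega> \<partial>M)"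
  proof (rule nn_integral_cong)
    fix \<omega> assume \<omega>: "\<omega> \<in> space M"
    interpret X: finite_measure "X t \<omega>" by (rule finite_measure_kernel[OF meas \<omega>])
    interpret Q: pair_sigma_finite lborel "X t \<omega>" ..
    have "(\<lambda>(s, x). g (x, s)) \<in> borel_measurable (lborel \<Otimes>\<^sub>M X t \<omega>)"
      using g_swap
      by (simp add: measurable_cong_sets[OF sets_pair_measure_cong[OF refl sets_finite_kernel[OF meas \<omega>]] refl])
    then show "(\<integral>\<^sup>+s. \<integral>\<^sup>+x. g (x, s) \<partial>X t \<omega> \<partial>lborel) = (\<integral>\<^sup>+x. \<integral>\<^sup>+s. g (x, s) \<partial>lborel \<partial>X t \<omega>)"
      by (intro Q.Fubini'[symmetric])
  qed
  finally show ?thesis .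
qed

text \<open>A Campbell formula: the identity for sets extends to functions by monotone approximation.\<close>

lemma nn_integral_intensity:
  assumes L: "L \<in> M \<rightarrow>\<^sub>M finite_measure_algebra K" and \<mu>: "sets \<mu> = sets K"
    and intensity: "\<And>A. A \<in> sets K \<Longrightarrow> (\<integral>\<^sup>+\<omega>. emeasure (L \<omega>) A \<partial>M) = c * emeasure \<mu> A"
    and g: "g \<in> borel_measurable K"
  shows "(\<integral>\<^sup>+\<omega>. \<integral>\<^sup>+x. g x \<partial>L \<omega> \<partial>M) = c * (\<integral>\<^sup>+x. g x \<partial>\<mu>)"
proof -
  note sets_L = sets_finite_kernel[OF L]
  have meas: "f \<in> borel_measurable (L \<omega>)" "f \<in> borel_measurable \<mu>"
    if "f \<in> borel_measurable K" "\<omega> \<in> space M" for f :: "_ \<Rightarrow> ennreal" and \<omega>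
    using that by (simp_all add: measurable_cong_sets[OF sets_L refl] measurable_cong_sets[OF \<mu> refl])
  have L_meas: "(\<lambda>\<omega>. \<integral>\<^sup>+x. f x \<partial>L \<omega>) \<in> borel_measurable M" if "f \<in> borel_measurable K" for f
    using that by (intro nn_integral_measurable_finite_kernel[OF _ L]) auto
  have \<mu>_meas: "f \<in> borel_measurable \<mu>" if "f \<in> borel_measurable K" for f :: "_ \<Rightarrow> ennreal"
    using that by (simp add: measurable_cong_sets[OF \<mu> refl])
  from g show ?thesis
  proof (induction rule: borel_measurable_induct)
    case (cong f g)
    have "(\<integral>\<^sup>+\<omega>. \<integral>\<^sup>+x. f x \<partial>L \<omega> \<partial>M) = (\<integral>\<^sup>+\<omega>. \<integral>\<^sup>+x. g x \<partial>L \<omega> \<partial>M)"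
      using cong space_finite_kernel[OF L] by (intro nn_integral_cong) auto
    moreover have "(\<integral>\<^sup>+x. f x \<partial>\<mu>) = (\<integral>\<^sup>+x. g x \<partial>\<mu>)"
      using cong sets_eq_imp_space_eq[OF \<mu>] by (intro nn_integral_cong) auto
    ultimately show ?case
      using cong by simp
  next
    case (set A)
    then have "(\<integral>\<^sup>+\<omega>. \<integral>\<^sup>+x. indicator A x \<partial>L \<omega> \<partial>M) = (\<integral>\<^sup>+\<omega>. emeasure (L \<omega>) A \<partial>M)"
      by (intro nn_integral_cong) (simp add: sets_L)
    with set show ?case
      by (simp add: intensity \<mu>)
  next
    case (mult u v)
    then have "(\<integral>\<^sup>+\<omega>. \<integral>\<^sup>+x. v * u x \<partial>L \<omega> \<partial>M) = v * (\<integral>\<^sup>+\<omega>. \<integral>\<^sup>+x. u x \<partial>L \<omega> \<partial>M)"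
      by (simp add: nn_integral_cmult meas L_meas cong: nn_integral_cong)
    with mult show ?case
      by (simp add: nn_integral_cmult \<mu>_meas mult_ac)
  next
    case (add u v)
    then have "(\<integral>\<^sup>+\<omega>. \<integral>\<^sup>+x. v x + u x \<partial>L \<omega> \<partial>M) =
        (\<integral>\<^sup>+\<omega>. \<integral>\<^sup>+x. v x \<partial>L \<omega> \<partial>M) + (\<integral>\<^sup>+\<omega>. \<integral>\<^sup>+x. u x \<partial>L \<omega> \<partial>M)"
      by (simp add: nn_integral_add meas L_meas cong: nn_integral_cong)
    with add show ?case
      by (simp add: nn_integral_add \<mu>_meas distrib_left)
  next
    case (seq U)
    have incseq_L: "incseq (\<lambda>i \<omega>. \<integral>\<^sup>+x. U i x \<partial>L \<omega>)"
      using \<open>incseq U\<close> by (auto simp: mono_def le_fun_def intro!: nn_integral_mono)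
    have "(\<integral>\<^sup>+\<omega>. \<integral>\<^sup>+x. (SUP i. U i) x \<partial>L \<omega> \<partial>M) = (\<integral>\<^sup>+\<omega>. (SUP i. \<integral>\<^sup>+x. U i x \<partial>L \<omega>) \<partial>M)"
      using seq by (intro nn_integral_cong)
        (simp add: SUP_apply image_comp, intro nn_integral_monotone_convergence_SUP, auto intro: meas)
    also have "\<dots> = (SUP i. \<integral>\<^sup>+\<omega>. \<integral>\<^sup>+x. U i x \<partial>L \<omega> \<partial>M)"
      using seq by (intro nn_integral_monotone_convergence_SUP incseq_L L_meas) auto
    also have "\<dots> = (SUP i. c * (\<integral>\<^sup>+x. U i x \<partial>\<mu>))"
      using seq by simp
    also have "\<dots> = c * (SUP i. \<integral>\<^sup>+x. U i x \<partial>\<mu>)"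
      by (simp add: SUP_mult_left_ennreal)
    also have "(SUP i. \<integral>\<^sup>+x. U i x \<partial>\<mu>) = (\<integral>\<^sup>+x. (SUP i. U i) x \<partial>\<mu>)"
      using seq by (simp add: SUP_apply image_comp)
        (intro nn_integral_monotone_convergence_SUP[symmetric], auto intro: \<mu>_meas)
    finally show ?case .
  qed
qed

text \<open>The isometry is an iterated Bochner integral, the stationarity argument an iterated integral
  of extended non-negative functions. They agree as soon as the latter is finite, because then
  the inner integrals are finite almost everywhere.\<close>

lemma integral_space_time_kernel:
  fixes X :: "real \<Rightarrow> 'w \<Rightarrow> 's measure" and g :: "'s \<times> real \<Rightarrow> real"
  assumes joint: "(\<lambda>(t, \<omega>). X t \<omega>) \<in> borel \<Otimes>\<^sub>M M \<rightarrow>\<^sub>M finite_measure_algebra K"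
    and g: "g \<in> borel_measurable (K \<Otimes>\<^sub>M borel)" and nonneg: "\<And>p. 0 \<le> g p"
    and finite: "(\<integral>\<^sup>+\<omega>. \<integral>\<^sup>+s. \<integral>\<^sup>+x. ennreal (g (x, s)) \<partial>X s \<omega> \<partial>lborel \<partial>M) < \<infinity>"
  shows "(\<integral>\<omega>. \<integral>s. \<integral>x. g (x, s) \<partial>X s \<omega> \<partial>lborel \<partial>M) =
    enn2real (\<integral>\<^sup>+\<omega>. \<integral>\<^sup>+s. \<integral>\<^sup>+x. ennreal (g (x, s)) \<partial>X s \<omega> \<partial>lborel \<partial>M)"
proof -
  define G where "G s \<omega> = (\<integral>\<^sup>+x. ennreal (g (x, s)) \<partial>X s \<omega>)" for s \<omega>
  define H where "H \<omega> = (\<integral>\<^sup>+s. G s \<omega> \<partial>lborel)" for \<omega>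
  have meas: "X s \<in> M \<rightarrow>\<^sub>M finite_measure_algebra K" for s
    using measurable_Pair2[OF joint, of s] by simp
  have g_fst: "(\<lambda>(p, x). ennreal (g (x, fst p))) \<in> borel_measurable ((borel \<Otimes>\<^sub>M M) \<Otimes>\<^sub>M K)"
    using g by measurable
  have "(\<lambda>p. \<integral>\<^sup>+x. ennreal (g (x, fst p)) \<partial>(case p of (t, \<omega>) \<Rightarrow> X t \<omega>)) \<in> borel_measurable (borel \<Otimes>\<^sub>M M)"
    by (rule nn_integral_measurable_finite_kernel[OF g_fst joint])
  then have G_meas[measurable]: "(\<lambda>(s, \<omega>). G s \<omega>) \<in> borel_measurable (borel \<Otimes>\<^sub>M M)"
    by (simp add: case_prod_unfold G_def)
  have H_meas[measurable]: "H \<in> borel_measurable M"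
    unfolding H_def by measurable
  have inner: "(\<integral>x. g (x, s) \<partial>X s \<omega>) = enn2real (G s \<omega>)" if "\<omega> \<in> space M" for s \<omega>
  proof -
    have "(\<lambda>x. g (x, s)) \<in> borel_measurable (X s \<omega>)"
      using measurable_Pair1[OF g, of s] by (simp add: measurable_cong_sets[OF sets_finite_kernel[OF meas that] refl])
    then show ?thesis
      unfolding G_def using nonneg by (intro integral_eq_nn_integral) auto
  qed
  have "(\<integral>\<^sup>+\<omega>. H \<omega> \<partial>M) < \<infinity>"
    using finite by (simp add: H_def G_def)
  then have H_finite: "AE \<omega> in M. H \<omega> \<noteq> \<infinity>"
    by (intro nn_integral_PInf_AE) auto
  have middle: "AE \<omega> in M. (\<integral>s. enn2real (G s \<omega>) \<partial>lborel) = enn2real (H \<omega>)"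
    using H_finite AE_space
  proof eventually_elim
    case (elim \<omega>)
    have [measurable]: "(\<lambda>s. G s \<omega>) \<in> borel_measurable borel"
      using measurable_Pair1[OF G_meas] elim by simp
    have "AE s in lborel. G s \<omega> \<noteq> \<infinity>"
      using elim by (intro nn_integral_PInf_AE) (auto simp: H_def)
    then have "(\<integral>\<^sup>+s. ennreal (enn2real (G s \<omega>)) \<partial>lborel) = H \<omega>"
      unfolding H_def by (intro nn_integral_cong_AE) (auto simp: less_top)
    then show ?case
      by (simp add: integral_eq_nn_integral)
  qed
  have "(\<integral>\<^sup>+\<omega>. ennreal (enn2real (H \<omega>)) \<partial>M) = (\<integral>\<^sup>+\<omega>. H \<omega> \<partial>M)"
    using H_finite by (intro nn_integral_cong_AE) (auto simp: less_top)
  moreover have "(\<integral>\<omega>. \<integral>s. \<integral>x. g (x, s) \<partial>X s \<omega> \<partial>lborel \<partial>M) = (\<integral>\<omega>. enn2real (H \<omega>) \<partial>M)"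
  proof -
    have "(\<integral>\<omega>. \<integral>s. \<integral>x. g (x, s) \<partial>X s \<omega> \<partial>lborel \<partial>M) = (\<integral>\<omega>. \<integral>s. enn2real (G s \<omega>) \<partial>lborel \<partial>M)"
      by (intro Bochner_Integration.integral_cong) (simp_all add: inner)
    also have "\<dots> = (\<integral>\<omega>. enn2real (H \<omega>) \<partial>M)"
      using middle by (intro integral_cong_AE) auto
    finally show ?thesis .
  qed
  moreover have "(\<integral>\<omega>. enn2real (H \<omega>) \<partial>M) = enn2real (\<integral>\<^sup>+\<omega>. ennreal (enn2real (H \<omega>)) \<partial>M)"
    by (intro integral_eq_nn_integral) auto
  ultimately show ?thesis
    by (simp only: H_def G_def)
qed

section \<open>Exponential integrals\<close>

lemma nn_integral_exp_decay:
  assumes "0 < k"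
  shows "(\<integral>\<^sup>+x. ennreal (indicator {0..} x * exp (- (k * x))) \<partial>lborel) = ennreal (1 / k)"
proof -
  have "((\<lambda>x. - exp (- (k * x)) / k) \<longlongrightarrow> 0) at_top"
    using assms by real_asymp
  then have "(\<integral>\<^sup>+x. ennreal (exp (- (k * x))) * indicator {0..} x \<partial>lborel) = ennreal (0 - (- exp (- (k * 0)) / k))"
    using assms
    by (intro nn_integral_FTC_atLeast[where F="\<lambda>x. - exp (- (k * x)) / k"])
       (auto intro!: derivative_eq_intros)
  then show ?thesis
    by (simp add: ennreal_mult' ennreal_indicator mult.commute)
qed

lemma nn_integral_exp_decay_shift:
  assumes "0 < k"
  shows "(\<integral>\<^sup>+x. ennreal (indicator {c..} x * exp (- (k * (x - c)))) \<partial>lborel) = ennreal (1 / k)"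
proof -
  have "(\<integral>\<^sup>+x. ennreal (indicator {c..} x * exp (- (k * (x - c)))) \<partial>lborel) =
     (\<integral>\<^sup>+x. ennreal (indicator {c..} (c + x) * exp (- (k * (c + x - c)))) \<partial>lborel)"
    by (subst nn_integral_real_affine[where c=1 and t=c]) auto
  also have "\<dots> = (\<integral>\<^sup>+x. ennreal (indicator {0..} x * exp (- (k * x))) \<partial>lborel)"
    by (intro nn_integral_cong) (auto simp: indicator_def)
  finally show ?thesis
    using nn_integral_exp_decay[OF assms] by simp
qed

lemma exp_quotient_nonneg: "0 \<le> c \<Longrightarrow> 0 \<le> exp_quotient c P r"
proof -
  assume "0 \<le> c"
  then have "P \<le> r \<Longrightarrow> P * c \<le> r * c" "r \<le> P \<Longrightarrow> r * c \<le> P * c"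
    by (auto intro: mult_right_mono)
  then show ?thesis
    using \<open>0 \<le> c\<close> by (cases "P \<le> r") (auto simp: exp_quotient_def zero_le_divide_iff)
qed

lemma exp_quotient_measurable[measurable]:
  assumes [measurable]: "f \<in> borel_measurable M" "g \<in> borel_measurable M" "k \<in> borel_measurable M"
  shows "(\<lambda>x. exp_quotient (f x) (g x) (k x)) \<in> borel_measurable M"
  unfolding exp_quotient_def by measurable

text \<open>The quotient in \<open>J\<close> is the convolution on \<open>{0..c}\<close> of the exponentials with rates \<open>P\<close> and \<open>r\<close>,
  including the confluent case \<open>P = r\<close>.\<close>

lemma nn_integral_exp_convolution:
  assumes "0 \<le> c"
  shows "(\<integral>\<^sup>+y. ennreal (indicator {0..c} y * exp (- (P * y) - r * (c - y))) \<partial>lborel) =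
    ennreal (exp_quotient c P r)"
proof -
  define F where "F y = (if P = r then y * exp (- (r * c)) else - exp (- (r * c) - (P - r) * y) / (P - r))" for y
  have "(\<integral>\<^sup>+y. ennreal (exp (- (P * y) - r * (c - y))) * indicator {0..c} y \<partial>lborel) = ennreal (F c - F 0)"
  proof (rule nn_integral_FTC_Icc)
    show "DERIV F y :> exp (- (P * y) - r * (c - y))" for y
    proof (cases "P = r")
      case True
      then show ?thesis
        unfolding F_def by (auto intro!: derivative_eq_intros simp: algebra_simps)
    next
      case False
      have "- (r * c) - (P - r) * y = - (P * y) - r * (c - y)"
        by (simp add: algebra_simps)
      moreover have "DERIV F y :> - (exp (- (r * c) - (P - r) * y) * - (P - r)) / (P - r)"
        unfolding F_def using False by (auto intro!: derivative_eq_intros)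
      moreover have "- (e * - d) / d = e" if "d \<noteq> 0" for d e :: real
        using that by simp
      then have "- (exp (- (r * c) - (P - r) * y) * - (P - r)) / (P - r) = exp (- (r * c) - (P - r) * y)"
        using False by (metis right_minus_eq)
      ultimately show ?thesis
        by metis
    qed
  qed (use assms in auto)
  also have "F c - F 0 = exp_quotient c P r"
  proof -
    have "- (r * c) - (P - r) * c = - (P * c)"
      by (simp add: algebra_simps)
    then show ?thesis
      by (simp add: F_def exp_quotient_def diff_divide_distrib)
  qed
  finally show ?thesis
    by (simp add: ennreal_mult' ennreal_indicator mult.commute)
qed

text \<open>Splitting the convolution over \<open>{0..c + d}\<close> at \<open>d\<close>; it is used with an age for \<open>c\<close> and the lag for \<open>d\<close>.\<close>

lemma exp_quotient_add:
  "exp_quotient (c + d) P r = exp (- (r * c)) * exp_quotient d P r + exp (- (P * d)) * exp_quotient c P r"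
proof (cases "P = r")
  case True
  then show ?thesis
    by (simp add: exp_quotient_def algebra_simps exp_add[symmetric])
next
  case False
  have "exp (- (r * (c + d))) - exp (- (P * (c + d))) =
      exp (- (r * c)) * (exp (- (r * d)) - exp (- (P * d))) + exp (- (P * d)) * (exp (- (r * c)) - exp (- (P * c)))"
    by (simp add: algebra_simps exp_add[symmetric])
  with False show ?thesis
    by (simp add: exp_quotient_def add_divide_distrib)
qed

text \<open>The Laplace transform of a convolution is the product of the Laplace transforms; Tonelli
  avoids a case distinction on \<open>P = r\<close>.\<close>

lemma nn_integral_exp_quotient:
  assumes "0 < R" "0 < P" "0 < r"
  shows "(\<integral>\<^sup>+x. ennreal (indicator {0..} x * (exp (- (R * x)) * exp_quotient x P r)) \<partial>lborel) =
    ennreal (1 / ((R + P) * (R + r)))"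
proof -
  let ?k = "\<lambda>x y. indicator {0..} y * exp (- ((R + P) * y)) * (indicator {y..} x * exp (- ((R + r) * (x - y))))"
  have "(\<integral>\<^sup>+x. ennreal (indicator {0..} x * (exp (- (R * x)) * exp_quotient x P r)) \<partial>lborel) =
      (\<integral>\<^sup>+x. \<integral>\<^sup>+y. ennreal (?k x y) \<partial>lborel \<partial>lborel)"
  proof (rule nn_integral_cong)
    fix x :: real
    show "ennreal (indicator {0..} x * (exp (- (R * x)) * exp_quotient x P r)) = (\<integral>\<^sup>+y. ennreal (?k x y) \<partial>lborel)"
    proof (cases "0 \<le> x")
      case True
      have "?k x y = exp (- (R * x)) * (indicator {0..x} y * exp (- (P * y) - r * (x - y)))" for y
        by (auto simp: indicator_def exp_add[symmetric] algebra_simps)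
      with True show ?thesis
        by (simp add: ennreal_mult' nn_integral_cmult nn_integral_exp_convolution[symmetric])
    next
      case False
      then have zero: "?k x y = 0" for y
        by (auto simp: indicator_def)
      show ?thesis
        unfolding zero using False by simp
    qed
  qed
  also have "\<dots> = (\<integral>\<^sup>+y. \<integral>\<^sup>+x. ennreal (?k x y) \<partial>lborel \<partial>lborel)"
  proof (rule lborel_pair.Fubini')
    have [measurable]: "Measurable.pred (borel \<Otimes>\<^sub>M borel) (\<lambda>p :: real \<times> real. snd p \<in> {fst p..})"
      unfolding atLeast_iff by measurable
    show "(\<lambda>(y, x). ennreal (?k x y)) \<in> borel_measurable (lborel \<Otimes>\<^sub>M lborel)"
      by measurable
  qed
  also have "\<dots> = (\<integral>\<^sup>+y. ennreal (1 / (R + r)) * ennreal (indicator {0..} y * exp (- ((R + P) * y))) \<partial>lborel)"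
    using nn_integral_exp_decay_shift[of "R + r"] assms
    by (intro nn_integral_cong) (simp add: ennreal_mult' nn_integral_cmult mult.commute)
  also have "\<dots> = ennreal (1 / (R + r)) * ennreal (1 / (R + P))"
    using nn_integral_exp_decay[of "R + P"] assms by (subst nn_integral_cmult) auto
  also have "\<dots> = ennreal (1 / ((R + P) * (R + r)))"
    using assms by (simp add: ennreal_mult'[symmetric] mult.commute)
  finally show ?thesis .
qed

lemma nn_integral_exp_two_sided:
  assumes "0 \<le> c" "0 < P" "0 < r"
  shows "(\<integral>\<^sup>+y. ennreal (indicator {0..} y * exp (- (P * y) - r * \<bar>c - y\<bar>)) \<partial>lborel) =
    ennreal (exp_quotient c P r + exp (- (P * c)) / (P + r))"
proof -
  have "(\<integral>\<^sup>+y. ennreal (indicator {0..} y * exp (- (P * y) - r * \<bar>c - y\<bar>)) \<partial>lborel) =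
    (\<integral>\<^sup>+y. ennreal (indicator {0..c} y * exp (- (P * y) - r * (c - y))) +
         ennreal (exp (- (P * c))) * ennreal (indicator {c..} y * exp (- ((P + r) * (y - c)))) \<partial>lborel)"
  proof (rule nn_integral_cong_AE)
    show "AE y in lborel. ennreal (indicator {0..} y * exp (- (P * y) - r * \<bar>c - y\<bar>)) =
      ennreal (indicator {0..c} y * exp (- (P * y) - r * (c - y))) +
         ennreal (exp (- (P * c))) * ennreal (indicator {c..} y * exp (- ((P + r) * (y - c))))"
      using AE_lborel_singleton[of c]
    proof eventually_elim
      case (elim y)
      with \<open>0 \<le> c\<close> show ?case
        by (auto simp: indicator_def ennreal_mult'[symmetric] exp_add[symmetric] algebra_simps)
    qed
  qed
  also have "\<dots> = ennreal (exp_quotient c P r) + ennreal (exp (- (P * c))) * ennreal (1 / (P + r))"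
    using assms
    by (simp add: nn_integral_add nn_integral_cmult nn_integral_exp_convolution nn_integral_exp_decay_shift)
  also have "\<dots> = ennreal (exp_quotient c P r + exp (- (P * c)) / (P + r))"
    using assms by (simp add: ennreal_mult'[symmetric] ennreal_plus[symmetric] exp_quotient_nonneg del: ennreal_plus)
  finally show ?thesis .
qed

text \<open>Here \<open>x\<close> and \<open>y\<close> are the ages seen from the times \<open>t\<close> and \<open>t + h\<close>, so that \<open>x + h - y\<close> is the
  signed difference of the two past times. The inner integral is two-sided around \<open>x + h\<close>.\<close>

lemma nn_integral_exp_double:
  assumes "0 < R" "0 < P" "0 < r" "0 \<le> h"
  shows "(\<integral>\<^sup>+x. \<integral>\<^sup>+y. ennreal (indicator {0..} x * exp (- (R * x))) *
        ennreal (indicator {0..} y * exp (- (P * y) - r * \<bar>x + h - y\<bar>)) \<partial>lborel \<partial>lborel) =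
    ennreal (exp (- (P * h)) / (P + R) * (1 / (P + r) + 1 / (R + r)) + exp_quotient h P r / (R + r))"
proof -
  have "(\<integral>\<^sup>+x. \<integral>\<^sup>+y. ennreal (indicator {0..} x * exp (- (R * x))) *
        ennreal (indicator {0..} y * exp (- (P * y) - r * \<bar>x + h - y\<bar>)) \<partial>lborel \<partial>lborel) =
     (\<integral>\<^sup>+x. ennreal (exp_quotient h P r) * ennreal (indicator {0..} x * exp (- ((R + r) * x))) +
        (ennreal (exp (- (P * h))) * ennreal (indicator {0..} x * (exp (- (R * x)) * exp_quotient x P r)) +
         ennreal (exp (- (P * h)) / (P + r)) * ennreal (indicator {0..} x * exp (- ((R + P) * x)))) \<partial>lborel)"
  proof (rule nn_integral_cong)
    fix x :: real
    show "(\<integral>\<^sup>+y. ennreal (indicator {0..} x * exp (- (R * x))) *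
        ennreal (indicator {0..} y * exp (- (P * y) - r * \<bar>x + h - y\<bar>)) \<partial>lborel) =
      ennreal (exp_quotient h P r) * ennreal (indicator {0..} x * exp (- ((R + r) * x))) +
        (ennreal (exp (- (P * h))) * ennreal (indicator {0..} x * (exp (- (R * x)) * exp_quotient x P r)) +
         ennreal (exp (- (P * h)) / (P + r)) * ennreal (indicator {0..} x * exp (- ((R + P) * x))))"
    proof (cases "0 \<le> x")
      case True
      have *: "exp (- (R * x)) * (exp_quotient (x + h) P r + exp (- (P * (x + h))) / (P + r)) =
          exp_quotient h P r * exp (- ((R + r) * x)) + (exp (- (P * h)) * (exp (- (R * x)) * exp_quotient x P r) +
          exp (- (P * h)) / (P + r) * exp (- ((R + P) * x)))"
        unfolding exp_quotient_add by (simp add: ring_distribs exp_add exp_diff exp_minus field_simps)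
      have "(\<integral>\<^sup>+y. ennreal (exp (- (R * x))) *
          ennreal (indicator {0..} y * exp (- (P * y) - r * \<bar>x + h - y\<bar>)) \<partial>lborel) =
        ennreal (exp (- (R * x))) * ennreal (exp_quotient (x + h) P r + exp (- (P * (x + h))) / (P + r))"
        using assms True by (subst nn_integral_cmult) (simp_all only: nn_integral_exp_two_sided, auto)
      also have "\<dots> = ennreal (exp_quotient h P r * exp (- ((R + r) * x)) + (exp (- (P * h)) * (exp (- (R * x)) * exp_quotient x P r) +
          exp (- (P * h)) / (P + r) * exp (- ((R + P) * x))))"
        by (subst *[symmetric]) (simp add: ennreal_mult')
      finally show ?thesis
        using assms True exp_quotient_nonneg[of h P r] exp_quotient_nonneg[of x P r]
        by (simp add: ennreal_mult'[symmetric] ennreal_plus[symmetric] del: ennreal_plus)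
    qed simp
  qed
  also have "\<dots> = ennreal (exp_quotient h P r) * ennreal (1 / (R + r)) +
      (ennreal (exp (- (P * h))) * ennreal (1 / ((R + P) * (R + r))) +
       ennreal (exp (- (P * h)) / (P + r)) * ennreal (1 / (R + P)))"
    using assms
    by (simp add: nn_integral_add nn_integral_cmult nn_integral_exp_quotient nn_integral_exp_decay)
  also have "\<dots> = ennreal (exp_quotient h P r * (1 / (R + r)) + (exp (- (P * h)) * (1 / ((R + P) * (R + r))) +
       exp (- (P * h)) / (P + r) * (1 / (R + P))))"
    using assms exp_quotient_nonneg[of h P r]
    by (simp add: ennreal_mult'[symmetric] ennreal_plus[symmetric] del: ennreal_plus)
  also have "exp_quotient h P r * (1 / (R + r)) + (exp (- (P * h)) * (1 / ((R + P) * (R + r))) +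
       exp (- (P * h)) / (P + r) * (1 / (R + P))) =
     exp (- (P * h)) / (P + R) * (1 / (P + r) + 1 / (R + r)) + exp_quotient h P r / (R + r)"
    using assms by (simp add: divide_simps) (simp add: algebra_simps)
  finally show ?thesis .
qed


text \<open>The weights in the drift as a law for the pair of a rate and a past time: the rate has law
  \<open>\<rho>\<close>, and given \<open>R\<close> the age \<open>t - s\<close> is exponential with parameter \<open>R\<close>.\<close>

definition memory_law :: "real measure \<Rightarrow> real \<Rightarrow> (real \<times> real) measure" where
  "memory_law \<rho> t =
     density (\<rho> \<Otimes>\<^sub>M lborel) (\<lambda>(R, s). ennreal (indicator {..t} s * (R * exp (- (R * (t - s))))))"

lemma sets_memory_law[measurable_cong]: "sets (memory_law \<rho> t) = sets (\<rho> \<Otimes>\<^sub>M borel)"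
  by (auto simp: memory_law_def intro: sets_pair_measure_cong)

lemma nn_integral_memory_law:
  assumes [measurable_cong]: "sets \<rho> = sets borel"
    and [measurable]: "f \<in> borel_measurable (borel \<Otimes>\<^sub>M borel)"
  shows "(\<integral>\<^sup>+p. f p \<partial>memory_law \<rho> t) =
    (\<integral>\<^sup>+R. \<integral>\<^sup>+x. ennreal (indicator {0..} x * (R * exp (- (R * x)))) * f (R, t - x) \<partial>lborel \<partial>\<rho>)"
proof -
  have "(\<integral>\<^sup>+p. f p \<partial>memory_law \<rho> t) =
    (\<integral>\<^sup>+p. ennreal (indicator {..t} (snd p) * (fst p * exp (- (fst p * (t - snd p))))) * f p \<partial>(\<rho> \<Otimes>\<^sub>M lborel))"
    unfolding memory_law_def by (subst nn_integral_density) (auto simp: case_prod_unfold)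
  also have "\<dots> = (\<integral>\<^sup>+R. \<integral>\<^sup>+s. ennreal (indicator {..t} s * (R * exp (- (R * (t - s))))) * f (R, s) \<partial>lborel \<partial>\<rho>)"
    by (subst lborel.nn_integral_fst[symmetric]) auto
  also have "\<dots> = (\<integral>\<^sup>+R. \<integral>\<^sup>+x. ennreal (indicator {0..} x * (R * exp (- (R * x)))) * f (R, t - x) \<partial>lborel \<partial>\<rho>)"
    by (rule nn_integral_cong, subst nn_integral_real_affine[where c="-1" and t=t])
       (auto simp: indicator_def intro!: nn_integral_cong)
  finally show ?thesis .
qed

lemma nn_integral_memory_law_rate:
  assumes [measurable_cong]: "sets \<rho> = sets borel" and pos: "AE R in \<rho>. 0 < R"
    and [measurable]: "g \<in> borel_measurable borel"
  shows "(\<integral>\<^sup>+p. g (fst p) \<partial>memory_law \<rho> t) = (\<integral>\<^sup>+R. g R \<partial>\<rho>)"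
proof -
  have "(\<integral>\<^sup>+p. g (fst p) \<partial>memory_law \<rho> t) =
      (\<integral>\<^sup>+R. \<integral>\<^sup>+x. ennreal (indicator {0..} x * (R * exp (- (R * x)))) * g R \<partial>lborel \<partial>\<rho>)"
    by (subst nn_integral_memory_law) (auto simp: assms(1))
  also have "\<dots> = (\<integral>\<^sup>+R. g R \<partial>\<rho>)"
  proof (rule nn_integral_cong_AE)
    show "AE R in \<rho>. (\<integral>\<^sup>+x. ennreal (indicator {0..} x * (R * exp (- (R * x)))) * g R \<partial>lborel) = g R"
      using pos
    proof eventually_elim
      case (elim R)
      have "(\<integral>\<^sup>+x. ennreal (indicator {0..} x * (R * exp (- (R * x)))) * g R \<partial>lborel) =
          (\<integral>\<^sup>+x. ennreal R * ennreal (indicator {0..} x * exp (- (R * x))) \<partial>lborel) * g R"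
        using elim by (subst nn_integral_multc) (auto simp: ennreal_mult'[symmetric] mult_ac)
      also have "\<dots> = ennreal R * ennreal (1 / R) * g R"
        using elim by (subst nn_integral_cmult) (simp_all only: nn_integral_exp_decay, auto)
      also have "\<dots> = g R"
        using elim by (simp add: ennreal_mult'[symmetric])
      finally show ?case .
    qed
  qed
  finally show ?thesis .
qed

lemma prob_space_memory_law:
  assumes "prob_space \<rho>" "sets \<rho> = sets borel" "AE R in \<rho>. 0 < R"
  shows "prob_space (memory_law \<rho> t)"
proof
  show "emeasure (memory_law \<rho> t) (space (memory_law \<rho> t)) = 1"
    using nn_integral_memory_law_rate[OF assms(2,3), of "\<lambda>_. 1" t] prob_space.emeasure_space_1[OF assms(1)]
    by simp
qed

lemma (in prob_space) nn_integral_unit_interval: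
  assumes "f \<in> borel_measurable M" "AE x in M. 0 \<le> f x \<and> f x \<le> 1"
  shows "(\<integral>\<^sup>+x. ennreal (f x) \<partial>M) = ennreal (\<integral>x. f x \<partial>M)" "0 \<le> (\<integral>x. f x \<partial>M) \<and> (\<integral>x. f x \<partial>M) \<le> 1"
proof -
  have int: "integrable M f"
    using assms by (intro integrable_const_bound[where B=1]) auto
  show "(\<integral>\<^sup>+x. ennreal (f x) \<partial>M) = ennreal (\<integral>x. f x \<partial>M)"
    using int assms(2) by (intro nn_integral_eq_integral) auto
  show "0 \<le> (\<integral>x. f x \<partial>M) \<and> (\<integral>x. f x \<partial>M) \<le> 1"
    using int assms(2) by (auto intro!: integral_nonneg_AE integral_le_const)
qed

text \<open>For functions with values in the unit interval every inner integral again lies in the unit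
  interval, so the two notions of integral agree at each level.\<close>

lemma nn_integral_triple_unit_interval:
  assumes "prob_space A" "prob_space B" "prob_space C"
    and meas: "(\<lambda>(x, y, z). f x y z) \<in> borel_measurable (A \<Otimes>\<^sub>M B \<Otimes>\<^sub>M C)"
    and bounds: "AE x in A. AE y in B. AE z in C. 0 \<le> f x y z \<and> f x y z \<le> (1::real)"
  shows "(\<integral>\<^sup>+x. \<integral>\<^sup>+y. \<integral>\<^sup>+z. ennreal (f x y z) \<partial>C \<partial>B \<partial>A) = ennreal (\<integral>x. \<integral>y. \<integral>z. f x y z \<partial>C \<partial>B \<partial>A)"
    and "0 \<le> (\<integral>x. \<integral>y. \<integral>z. f x y z \<partial>C \<partial>B \<partial>A)"
proof -
  interpret A: prob_space A by fact
  interpret B: prob_space B by fact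
  interpret C: prob_space C by fact
  have [measurable]: "(\<lambda>p. f (fst (fst p)) (snd (fst p)) (snd p)) \<in> borel_measurable ((A \<Otimes>\<^sub>M B) \<Otimes>\<^sub>M C)"
    using measurable_compose[OF _ meas, of "\<lambda>p. (fst (fst p), snd (fst p), snd p)" "(A \<Otimes>\<^sub>M B) \<Otimes>\<^sub>M C"]
    by simp
  have z_meas: "f x y \<in> borel_measurable C" if "x \<in> space A" "y \<in> space B" for x y
    using measurable_compose[OF _ meas, of "\<lambda>z. (x, y, z)" C] that by simp
  have y_meas: "(\<lambda>y. \<integral>z. f x y z \<partial>C) \<in> borel_measurable B" if "x \<in> space A" for x
    using measurable_compose[OF _ meas, of "\<lambda>(y, z). (x, y, z)" "B \<Otimes>\<^sub>M C"] that
    by (intro C.borel_measurable_lebesgue_integral) (simp add: case_prod_unfold)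
  have x_meas: "(\<lambda>x. \<integral>y. \<integral>z. f x y z \<partial>C \<partial>B) \<in> borel_measurable A"
    by (intro B.borel_measurable_lebesgue_integral C.borel_measurable_lebesgue_integral)
       (simp add: case_prod_unfold)
  have z_step: "AE x in A. AE y in B. (\<integral>\<^sup>+z. ennreal (f x y z) \<partial>C) = ennreal (\<integral>z. f x y z \<partial>C) \<and>
      0 \<le> (\<integral>z. f x y z \<partial>C) \<and> (\<integral>z. f x y z \<partial>C) \<le> 1"
    using bounds AE_space
  proof eventually_elim
    case (elim x)
    from elim(1) AE_space show ?case
    proof eventually_elim
      case (elim y)
      then show ?case
        using C.nn_integral_unit_interval[OF z_meas[OF \<open>x \<in> space A\<close>]] by auto
    qed
  qed
  have y_step: "AE x in A. (\<integral>\<^sup>+y. \<integral>\<^sup>+z. ennreal (f x y z) \<partial>C \<partial>B) = ennreal (\<integral>y. \<integral>z. f x y z \<partial>C \<partial>B) \<and>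
      0 \<le> (\<integral>y. \<integral>z. f x y z \<partial>C \<partial>B) \<and> (\<integral>y. \<integral>z. f x y z \<partial>C \<partial>B) \<le> 1"
    using z_step AE_space
  proof eventually_elim
    case (elim x)
    then have "(\<integral>\<^sup>+y. \<integral>\<^sup>+z. ennreal (f x y z) \<partial>C \<partial>B) = (\<integral>\<^sup>+y. ennreal (\<integral>z. f x y z \<partial>C) \<partial>B)"
      by (intro nn_integral_cong_AE) auto
    moreover have "AE y in B. 0 \<le> (\<integral>z. f x y z \<partial>C) \<and> (\<integral>z. f x y z \<partial>C) \<le> 1"
      using elim by auto
    ultimately show ?case
      using B.nn_integral_unit_interval[OF y_meas] elim by auto
  qed
  have "(\<integral>\<^sup>+x. \<integral>\<^sup>+y. \<integral>\<^sup>+z. ennreal (f x y z) \<partial>C \<partial>B \<partial>A) = (\<integral>\<^sup>+x. ennreal (\<integral>y. \<integral>z. f x y z \<partial>C \<partial>B) \<partial>A)"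
    using y_step by (intro nn_integral_cong_AE) auto
  moreover have "AE x in A. 0 \<le> (\<integral>y. \<integral>z. f x y z \<partial>C \<partial>B) \<and> (\<integral>y. \<integral>z. f x y z \<partial>C \<partial>B) \<le> 1"
    using y_step by auto
  ultimately show "(\<integral>\<^sup>+x. \<integral>\<^sup>+y. \<integral>\<^sup>+z. ennreal (f x y z) \<partial>C \<partial>B \<partial>A) = ennreal (\<integral>x. \<integral>y. \<integral>z. f x y z \<partial>C \<partial>B \<partial>A)"
    and "0 \<le> (\<integral>x. \<integral>y. \<integral>z. f x y z \<partial>C \<partial>B \<partial>A)"
    using A.nn_integral_unit_interval[OF x_meas] by auto
qed


text \<open>The convolution is at most the integral of \<open>exp (- P y)\<close> over the half-line.\<close>

lemma mult_exp_quotient_le_1: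
  assumes "0 \<le> c" "0 < P" "0 < r"
  shows "P * exp_quotient c P r \<le> 1"
proof -
  have "ennreal (exp_quotient c P r) \<le> (\<integral>\<^sup>+y. ennreal (indicator {0..} y * exp (- (P * y))) \<partial>lborel)"
    unfolding nn_integral_exp_convolution[OF assms(1), symmetric]
    using assms by (intro nn_integral_mono ennreal_leI) (auto simp: indicator_def)
  then have "exp_quotient c P r \<le> 1 / P"
    using assms by (simp add: nn_integral_exp_decay)
  then show ?thesis
    using assms by (simp add: field_simps)
qed

text \<open>After Tonelli the rates \<open>R\<close>, \<open>P\<close>, \<open>r\<close> are outermost and the double integral over the ages is the
  explicit one above. Both summands lie between zero and one for positive rates, which allows
  the passage back to Bochner integrals and their separation.\<close>

lemma memory_law_exp_correlation:
  assumes \<rho>: "prob_space \<rho>" "sets \<rho> = sets borel" "AE R in \<rho>. 0 < R"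
    and \<theta>: "prob_space \<theta>" "sets \<theta> = sets borel" "AE r in \<theta>. 0 < r"
    and h: "0 \<le> h"
  shows "(\<integral>p. \<integral>q. \<integral>r. exp (- (r * \<bar>snd p - snd q\<bar>)) \<partial>\<theta> \<partial>memory_law \<rho> (t + h) \<partial>memory_law \<rho> t) =
    I_integral \<rho> \<theta> h + J_integral \<rho> \<theta> h" (is "?C = _")
proof -
  note [measurable_cong] = \<rho>(2) \<theta>(2)
  interpret \<rho>: prob_space \<rho> by fact
  interpret \<theta>: prob_space \<theta> by fact
  interpret lr: pair_sigma_finite lborel \<rho> ..
  interpret lt: pair_sigma_finite lborel \<theta> ..
  note law = prob_space_memory_law[OF \<rho>]
  define k where "k R x = ennreal (indicator {0..} x * (R * exp (- (R * x))))" for R x :: real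
  define w where "w x y r = ennreal (exp (- (r * \<bar>x + h - y\<bar>)))" for x y r :: real
  have [measurable]: "(\<lambda>p. k (f p) (g p)) \<in> borel_measurable N"
    if "f \<in> borel_measurable N" "g \<in> borel_measurable N" for f g and N :: "'z measure"
    using that unfolding k_def by measurable
  have [measurable]: "(\<lambda>p. w (f p) (g p) (f' p)) \<in> borel_measurable N"
    if "f \<in> borel_measurable N" "g \<in> borel_measurable N" "f' \<in> borel_measurable N"
    for f g f' and N :: "'z measure"
    using that unfolding w_def by measurable
  define I J where "I R P r = R * P / (P + R) * (1 / (P + r) + 1 / (R + r)) * exp (- P * h)"
    and "J R P r = R * P / (R + r) * exp_quotient h P r" for R P r
  have pos: "AE R in \<rho>. AE P in \<rho>. AE r in \<theta>. 0 < R \<and> 0 < P \<and> 0 < r"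
    using \<rho>(3)
  proof eventually_elim
    case (elim R)
    show ?case
      using \<rho>(3)
    proof eventually_elim
      case (elim P)
      show ?case
        by (rule eventually_mono[OF \<theta>(3)]) (use \<open>0 < R\<close> \<open>0 < P\<close> in auto)
    qed
  qed
  have pos_lift: "AE R in \<rho>. AE P in \<rho>. AE r in \<theta>. C R P r"
    if "\<And>R P r. 0 < R \<and> 0 < P \<and> 0 < r \<Longrightarrow> C R P r" for C
    by (rule eventually_mono[OF pos], erule eventually_mono, erule eventually_mono, erule that)
  have I_bounds: "0 \<le> I R P r \<and> I R P r \<le> 1" if "0 < R \<and> 0 < P \<and> 0 < r" for R P r
  proof -
    have "R * P / (P + R) * (1 / (P + r) + 1 / (R + r)) \<le> R * P / (P + R) * (1 / P + 1 / R)"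
      using that by (intro mult_left_mono add_mono divide_left_mono) auto
    also have "\<dots> = 1"
      using that by (simp add: divide_simps)
    finally have "I R P r \<le> 1 * 1"
      unfolding I_def using that h by (intro mult_mono) auto
    then show ?thesis
      using that by (auto simp: I_def)
  qed
  have J_bounds: "0 \<le> J R P r \<and> J R P r \<le> 1" if "0 < R \<and> 0 < P \<and> 0 < r" for R P r
  proof -
    have "J R P r = R / (R + r) * (P * exp_quotient h P r)"
      by (simp add: J_def)
    also have "\<dots> \<le> 1 * 1"
      using that h mult_exp_quotient_le_1[of h P r] exp_quotient_nonneg[of h P r] by (intro mult_mono) auto
    finally show ?thesis
      using that h exp_quotient_nonneg[of h P r] by (auto simp: J_def)
  qed
  have I_meas[measurable]: "(\<lambda>p. I (f p) (g p) (f' p)) \<in> borel_measurable N"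
    and J_meas[measurable]: "(\<lambda>p. J (f p) (g p) (f' p)) \<in> borel_measurable N"
    if "f \<in> borel_measurable N" "g \<in> borel_measurable N" "f' \<in> borel_measurable N"
    for f g f' and N :: "'z measure"
    using that unfolding I_def J_def by measurable
  note triple = nn_integral_triple_unit_interval[OF \<rho>(1) \<rho>(1) \<theta>(1) _ pos_lift]
  have I_triple: "(\<integral>\<^sup>+R. \<integral>\<^sup>+P. \<integral>\<^sup>+r. ennreal (I R P r) \<partial>\<theta> \<partial>\<rho> \<partial>\<rho>) = ennreal (I_integral \<rho> \<theta> h)"
      "0 \<le> I_integral \<rho> \<theta> h"
    unfolding I_integral_def I_def[symmetric]
    by (rule triple[OF _ I_bounds]; simp add: case_prod_unfold)+
  have J_triple: "(\<integral>\<^sup>+R. \<integral>\<^sup>+P. \<integral>\<^sup>+r. ennreal (J R P r) \<partial>\<theta> \<partial>\<rho> \<partial>\<rho>) = ennreal (J_integral \<rho> \<theta> h)"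
      "0 \<le> J_integral \<rho> \<theta> h"
    unfolding J_integral_def J_def[symmetric]
    by (rule triple[OF _ J_bounds]; simp add: case_prod_unfold)+
  have "ennreal ?C = (\<integral>\<^sup>+p. \<integral>\<^sup>+q. \<integral>\<^sup>+r. ennreal (exp (- (r * \<bar>snd p - snd q\<bar>))) \<partial>\<theta> \<partial>memory_law \<rho> (t + h) \<partial>memory_law \<rho> t)"
  proof (rule nn_integral_triple_unit_interval(1)[OF law law \<theta>(1), symmetric])
    show "AE p in memory_law \<rho> t. AE q in memory_law \<rho> (t + h). AE r in \<theta>.
        0 \<le> exp (- (r * \<bar>snd p - snd q\<bar>)) \<and> exp (- (r * \<bar>snd p - snd q\<bar>)) \<le> 1"
      by (rule AE_I2, rule AE_I2, rule eventually_mono[OF \<theta>(3)]) auto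
  qed measurable
  also have "\<dots> = (\<integral>\<^sup>+R. \<integral>\<^sup>+x. k R x * (\<integral>\<^sup>+P. \<integral>\<^sup>+y. k P y * (\<integral>\<^sup>+r. w x y r \<partial>\<theta>) \<partial>lborel \<partial>\<rho>) \<partial>lborel \<partial>\<rho>)"
  proof -
    have "\<bar>t - x - (t + h - y)\<bar> = \<bar>x + h - y\<bar>" for x y
      by arith
    then show ?thesis
      by (simp add: nn_integral_memory_law[OF \<rho>(2)] k_def w_def)
  qed
  also have "\<dots> = (\<integral>\<^sup>+R. \<integral>\<^sup>+x. \<integral>\<^sup>+P. \<integral>\<^sup>+y. \<integral>\<^sup>+r. k R x * (k P y * w x y r) \<partial>\<theta> \<partial>lborel \<partial>\<rho> \<partial>lborel \<partial>\<rho>)"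
    by (simp add: nn_integral_cmult)
  also have "\<dots> = (\<integral>\<^sup>+R. \<integral>\<^sup>+P. \<integral>\<^sup>+x. \<integral>\<^sup>+y. \<integral>\<^sup>+r. k R x * (k P y * w x y r) \<partial>\<theta> \<partial>lborel \<partial>lborel \<partial>\<rho> \<partial>\<rho>)"
    by (rule nn_integral_cong, rule lr.Fubini'[symmetric]) measurable
  also have "\<dots> = (\<integral>\<^sup>+R. \<integral>\<^sup>+P. \<integral>\<^sup>+x. \<integral>\<^sup>+r. \<integral>\<^sup>+y. k R x * (k P y * w x y r) \<partial>lborel \<partial>\<theta> \<partial>lborel \<partial>\<rho> \<partial>\<rho>)"
    by (rule nn_integral_cong, rule nn_integral_cong, rule nn_integral_cong, rule lt.Fubini'[symmetric]) measurable
  also have "\<dots> = (\<integral>\<^sup>+R. \<integral>\<^sup>+P. \<integral>\<^sup>+r. \<integral>\<^sup>+x. \<integral>\<^sup>+y. k R x * (k P y * w x y r) \<partial>lborel \<partial>lborel \<partial>\<theta> \<partial>\<rho> \<partial>\<rho>)"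
    by (rule nn_integral_cong, rule nn_integral_cong, rule lt.Fubini'[symmetric]) measurable
  also have "\<dots> = (\<integral>\<^sup>+R. \<integral>\<^sup>+P. \<integral>\<^sup>+r. ennreal (I R P r) + ennreal (J R P r) \<partial>\<theta> \<partial>\<rho> \<partial>\<rho>)"
  proof -
    have "(\<integral>\<^sup>+x. \<integral>\<^sup>+y. k R x * (k P y * w x y r) \<partial>lborel \<partial>lborel) = ennreal (I R P r) + ennreal (J R P r)"
      if "0 < R \<and> 0 < P \<and> 0 < r" for R P r
    proof -
      let ?g = "\<lambda>x y. ennreal (indicator {0..} x * exp (- (R * x))) *
        ennreal (indicator {0..} y * exp (- (P * y) - r * \<bar>x + h - y\<bar>))"
      have "k R x * (k P y * w x y r) = ennreal (R * P) * ?g x y" for x y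
        using that by (simp add: k_def w_def ennreal_mult'[symmetric] exp_diff exp_minus field_simps)
      then have "(\<integral>\<^sup>+x. \<integral>\<^sup>+y. k R x * (k P y * w x y r) \<partial>lborel \<partial>lborel) =
          ennreal (R * P) * (\<integral>\<^sup>+x. \<integral>\<^sup>+y. ?g x y \<partial>lborel \<partial>lborel)"
        by (simp add: nn_integral_cmult)
      also have "\<dots> = ennreal (R * P * (exp (- (P * h)) / (P + R) * (1 / (P + r) + 1 / (R + r)) + exp_quotient h P r / (R + r)))"
        using that h by (subst nn_integral_exp_double) (auto simp: ennreal_mult')
      also have "R * P * (exp (- (P * h)) / (P + R) * (1 / (P + r) + 1 / (R + r)) + exp_quotient h P r / (R + r)) =
          I R P r + J R P r"
      proof -
        have "R * P * (e / (P + R) * S + q / (R + r)) = R * P / (P + R) * S * e + R * P / (R + r) * q" for e S q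
          by (simp add: algebra_simps)
        then show ?thesis
          unfolding I_def J_def mult_minus_left .
      qed
      finally show ?thesis
        using I_bounds[OF that] J_bounds[OF that] by simp
    qed
    then show ?thesis
      using pos by (intro nn_integral_cong_AE) (fastforce elim!: eventually_mono intro!: nn_integral_cong_AE)
  qed
  also have "\<dots> = (\<integral>\<^sup>+R. \<integral>\<^sup>+P. \<integral>\<^sup>+r. ennreal (I R P r) \<partial>\<theta> \<partial>\<rho> \<partial>\<rho>) + (\<integral>\<^sup>+R. \<integral>\<^sup>+P. \<integral>\<^sup>+r. ennreal (J R P r) \<partial>\<theta> \<partial>\<rho> \<partial>\<rho>)"
    by (simp add: nn_integral_add)
  also have "\<dots> = ennreal (I_integral \<rho> \<theta> h) + ennreal (J_integral \<rho> \<theta> h)"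
    using I_triple J_triple by simp
  finally have "ennreal ?C = ennreal (I_integral \<rho> \<theta> h) + ennreal (J_integral \<rho> \<theta> h)" .
  moreover have "0 \<le> ?C"
    by (intro integral_nonneg_AE) auto
  ultimately show ?thesis
    using I_triple(2) J_triple(2) by (simp add: ennreal_plus[symmetric] del: ennreal_plus)
qed

section \<open>Laws on the half-line, viewed on the real line\<close>

text \<open>The rate laws live on \<open>{0<..}\<close>. Their images under the inclusion into the line are measures on
  \<open>borel\<close>, where products and densities are directly measurable; positivity of the rates
  survives as an almost sure statement.\<close>

lemma extend_pos_borel:
  assumes \<mu>: "prob_space \<mu>" "sets \<mu> = sets pos_borel"
  defines "\<nu> \<equiv> distr \<mu> borel (\<lambda>x. x)"
  shows "prob_space \<nu>" "sets \<nu> = sets borel" "AE x in \<nu>. 0 < x"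
    and "(\<lambda>x. x) \<in> borel_measurable \<mu>"
    and "space \<mu> = {0<..}"
proof -
  show sp: "space \<mu> = {0<..}"
    using sets_eq_imp_space_eq[OF \<mu>(2)] by (simp add: space_restrict_space)
  show id: "(\<lambda>x. x) \<in> borel_measurable \<mu>"
    by (simp add: measurable_cong_sets[OF \<mu>(2) refl] measurable_restrict_space1)
  show "prob_space \<nu>"
    unfolding \<nu>_def by (rule prob_space.prob_space_distr[OF \<mu>(1) id])
  show "sets \<nu> = sets borel"
    by (simp add: \<nu>_def)
  have "AE x in \<mu>. 0 < x"
    using AE_space by eventually_elim (simp add: sp)
  then show "AE x in \<nu>. 0 < x"
    unfolding \<nu>_def by (subst AE_distr_iff[OF id]) auto
qed

lemma I_J_integral_extend:
  assumes \<rho>: "prob_space \<rho>" "sets \<rho> = sets pos_borel" and \<theta>: "prob_space \<theta>" "sets \<theta> = sets pos_borel"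
  defines "\<rho>' \<equiv> distr \<rho> borel (\<lambda>x. x)" and "\<theta>' \<equiv> distr \<theta> borel (\<lambda>x. x)"
  shows "I_integral \<rho>' \<theta>' h = I_integral \<rho> \<theta> h" and "J_integral \<rho>' \<theta>' h = J_integral \<rho> \<theta> h"
proof -
  note ext_\<rho> = extend_pos_borel[OF \<rho>] and ext_\<theta> = extend_pos_borel[OF \<theta>]
  interpret \<rho>': prob_space \<rho>' using ext_\<rho>(1) by (simp add: \<rho>'_def)
  interpret \<theta>': prob_space \<theta>' using ext_\<theta>(1) by (simp add: \<theta>'_def)
  have [measurable_cong]: "sets \<rho>' = sets borel" "sets \<theta>' = sets borel"
    by (simp_all add: \<rho>'_def \<theta>'_def)
  have triple: "(\<integral>R. \<integral>P. \<integral>r. f R P r \<partial>\<theta>' \<partial>\<rho>' \<partial>\<rho>') = (\<integral>R. \<integral>P. \<integral>r. f R P r \<partial>\<theta> \<partial>\<rho> \<partial>\<rho>)"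
    if f[measurable]: "(\<lambda>p. f (fst (fst p)) (snd (fst p)) (snd p)) \<in> borel_measurable ((borel \<Otimes>\<^sub>M borel) \<Otimes>\<^sub>M borel)"
    for f :: "real \<Rightarrow> real \<Rightarrow> real \<Rightarrow> real"
  proof -
    have "(\<integral>R. \<integral>P. \<integral>r. f R P r \<partial>\<theta>' \<partial>\<rho>' \<partial>\<rho>') = (\<integral>R. \<integral>P. \<integral>r. f R P r \<partial>\<theta>' \<partial>\<rho>' \<partial>\<rho>)"
    proof -
      have "(\<lambda>R. \<integral>P. \<integral>r. f R P r \<partial>\<theta>' \<partial>\<rho>') \<in> borel_measurable borel"
        by measurable
      from integral_distr[OF ext_\<rho>(4) this] show ?thesis
        unfolding \<rho>'_def[symmetric] .
    qed
    also have "\<dots> = (\<integral>R. \<integral>P. \<integral>r. f R P r \<partial>\<theta>' \<partial>\<rho> \<partial>\<rho>)"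
    proof (rule Bochner_Integration.integral_cong[OF refl])
      fix R
      have [measurable]: "(\<lambda>x. f R (fst x) (snd x)) \<in> borel_measurable (borel \<Otimes>\<^sub>M borel)"
        using measurable_compose[OF _ f, of "\<lambda>x. ((R, fst x), snd x)" "borel \<Otimes>\<^sub>M borel"] by simp
      have "(\<lambda>P. \<integral>r. f R P r \<partial>\<theta>') \<in> borel_measurable borel"
        by measurable
      then show "(\<integral>P. \<integral>r. f R P r \<partial>\<theta>' \<partial>\<rho>') = (\<integral>P. \<integral>r. f R P r \<partial>\<theta>' \<partial>\<rho>)"
        unfolding \<rho>'_def by (rule integral_distr[OF ext_\<rho>(4)])
    qed
    also have "\<dots> = (\<integral>R. \<integral>P. \<integral>r. f R P r \<partial>\<theta> \<partial>\<rho> \<partial>\<rho>)"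
    proof (rule Bochner_Integration.integral_cong[OF refl], rule Bochner_Integration.integral_cong[OF refl])
      fix R P
      have "f R P \<in> borel_measurable borel"
        using measurable_compose[OF _ f, of "\<lambda>r. ((R, P), r)" borel] by simp
      then show "(\<integral>r. f R P r \<partial>\<theta>') = (\<integral>r. f R P r \<partial>\<theta>)"
        unfolding \<theta>'_def by (rule integral_distr[OF ext_\<theta>(4)])
    qed
    finally show ?thesis .
  qed
  show "I_integral \<rho>' \<theta>' h = I_integral \<rho> \<theta> h" "J_integral \<rho>' \<theta>' h = J_integral \<rho> \<theta> h"
    unfolding I_integral_def J_integral_def by (rule triple, measurable)+
qed

section \<open>The memory process\<close>

context discharge
begin

lemma Q_measurable[measurable]: "Q t \<in> borel_measurable M"
  using measurable_Pair2[OF Q_jointly_measurable, of t] by simp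

lemma Q_square_integrable: "square_integrable M (Q t)"
  using Q_variance[of t] Vbar_pos by (intro square_integrable_if_variance_pos) auto

lemma Q_second_moment: "expectation (\<lambda>\<omega>. (Q t \<omega>)\<^sup>2) = Vbar + Qbar\<^sup>2"
  using variance_eq[of "Q t"] Q_square_integrable[of t] Q_variance[of t] Q_mean[of t]
  by (simp add: square_integrable_def integrable_if_square_integrable[OF Q_square_integrable])

text \<open>The second moment of \<open>Q\<close> is the same at all times.\<close>

lemma Q_average_square_integrable:
  fixes N :: "(real \<times> real) measure"
  assumes N: "prob_space N" and sets_N[measurable_cong]: "sets N = sets (borel \<Otimes>\<^sub>M borel)"
  shows "square_integrable (N \<Otimes>\<^sub>M M) (\<lambda>(p, \<omega>). Q (snd p) \<omega>)"
proof -
  note Q_jointly_measurable[measurable]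
  interpret N: prob_space N by fact
  have meas[measurable]: "(\<lambda>(p, \<omega>). Q (snd p) \<omega>) \<in> borel_measurable (N \<Otimes>\<^sub>M M)"
    by measurable
  have "(\<integral>\<^sup>+z. ennreal ((Q (snd (fst z)) (snd z))\<^sup>2) \<partial>(N \<Otimes>\<^sub>M M)) =
      (\<integral>\<^sup>+p. \<integral>\<^sup>+\<omega>. ennreal ((Q (snd p) \<omega>)\<^sup>2) \<partial>M \<partial>N)"
    by (subst nn_integral_fst[symmetric]) auto
  also have "\<dots> = (\<integral>\<^sup>+p. ennreal (Vbar + Qbar\<^sup>2) \<partial>N)"
    using Q_square_integrable
    by (intro nn_integral_cong) (simp add: square_integrable_def nn_integral_eq_integral Q_second_moment)
  also have "\<dots> < \<infinity>"
    by (simp add: N.emeasure_space_1 ennreal_mult_less_top)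
  finally show ?thesis
    using meas by (simp add: square_integrable_def case_prod_unfold integrable_iff_bounded)
qed

end

context memory_process
begin

abbreviation rate_law :: "real measure" where "rate_law \<equiv> distr \<rho> borel (\<lambda>R. R)"
abbreviation correlation_law :: "real measure" where "correlation_law \<equiv> distr \<theta> borel (\<lambda>r. r)"

lemmas rate_law = extend_pos_borel[OF prob_space_\<rho> sets_\<rho>]
lemmas correlation_law = extend_pos_borel[OF prob_space_\<theta> sets_\<theta>]

lemma prob_space_law: "prob_space (memory_law rate_law t)"
  by (intro prob_space_memory_law rate_law)

lemma sets_law: "sets (memory_law rate_law t) = sets (borel \<Otimes>\<^sub>M borel)"
  by (simp add: sets_memory_law cong: sets_pair_measure_cong)

definition drive :: "real set \<Rightarrow> real \<times> real \<Rightarrow> 'w \<Rightarrow> real" where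
  "drive A p \<omega> = indicator A (fst p) * (a + b * Q (snd p) \<omega>)"

definition drift :: "real set \<Rightarrow> real \<Rightarrow> 'w \<Rightarrow> real" where
  "drift A t \<omega> = (\<integral>p. drive A p \<omega> \<partial>memory_law rate_law t)"

lemma averaged_process_drive:
  assumes [measurable]: "A \<in> sets borel"
  shows "averaged_process M (memory_law rate_law t) (drive A)"
proof (intro averaged_process.intro averaged_process_axioms.intro)
  show "prob_space M" "prob_space (memory_law rate_law t)"
    by (rule prob_space_axioms prob_space_law)+
  note [measurable_cong] = sets_law[of t]
  interpret N: prob_space "memory_law rate_law t" by (rule prob_space_law)
  interpret P: pair_prob_space "memory_law rate_law t" M ..
  have "square_integrable (memory_law rate_law t \<Otimes>\<^sub>M M) (\<lambda>z. a + b * (case z of (p, \<omega>) \<Rightarrow> Q (snd p) \<omega>))"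
    by (intro square_integrable_add square_integrable_cmult P.square_integrable_const
        Q_average_square_integrable prob_space_law sets_law)
  then have sq: "square_integrable (memory_law rate_law t \<Otimes>\<^sub>M M) (\<lambda>z. a + b * Q (snd (fst z)) (snd z))"
    by (simp add: case_prod_unfold)
  have meas: "(\<lambda>z. drive A (fst z) (snd z)) \<in> borel_measurable (memory_law rate_law t \<Otimes>\<^sub>M M)"
    unfolding drive_def using square_integrable_measurable[OF sq] by measurable
  moreover have "integrable (memory_law rate_law t \<Otimes>\<^sub>M M) (\<lambda>z. (drive A (fst z) (snd z))\<^sup>2)"
  proof (rule Bochner_Integration.integrable_bound)
    show "integrable (memory_law rate_law t \<Otimes>\<^sub>M M) (\<lambda>z. (a + b * Q (snd (fst z)) (snd z))\<^sup>2)"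
      using sq by (simp add: square_integrable_def)
    show "(\<lambda>z. (drive A (fst z) (snd z))\<^sup>2) \<in> borel_measurable (memory_law rate_law t \<Otimes>\<^sub>M M)"
      using meas by (rule borel_measurable_power)
    show "AE z in memory_law rate_law t \<Otimes>\<^sub>M M.
        norm ((drive A (fst z) (snd z))\<^sup>2) \<le> norm ((a + b * Q (snd (fst z)) (snd z))\<^sup>2)"
      by (rule AE_I2) (simp add: drive_def indicator_def)
  qed
  ultimately show "square_integrable (memory_law rate_law t \<Otimes>\<^sub>M M) (\<lambda>(p, \<omega>). drive A p \<omega>)"
    by (simp add: square_integrable_def case_prod_unfold)
qed

text \<open>The first summand in the equation for \<open>m\<close>, as an average over \<open>memory_law\<close>. The set \<open>A\<close> ranges over
  the whole line, so that \<open>A = UNIV\<close> describes the total mass without an indicator.\<close>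

lemma drift_eq:
  assumes [measurable]: "A \<in> sets borel" and \<omega>: "\<omega> \<in> space M"
  shows "(\<integral>(R, s). indicator (A \<inter> {0<..}) R * indicator {..t} s * exp (- R * (t - s)) *
      (R * (a + b * Q s \<omega>)) \<partial>(\<rho> \<Otimes>\<^sub>M lborel)) = drift A t \<omega>"
proof -
  have Q_path[measurable]: "(\<lambda>s. Q s \<omega>) \<in> borel_measurable borel"
    using measurable_Pair1[OF Q_jointly_measurable \<omega>] by simp
  (* The maximum makes the density non-negative everywhere, as integral_density requires. *)
  let ?g = "\<lambda>p :: real \<times> real. max 0 (indicator {..t} (snd p) * (fst p * exp (- fst p * (t - snd p))))"
  let ?incl = "\<lambda>(R, s). (R :: real, s :: real)"
  interpret rl: prob_space rate_law by (rule rate_law)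
  have drive_meas[measurable]: "(\<lambda>p. drive A p \<omega>) \<in> borel_measurable (borel \<Otimes>\<^sub>M borel)"
    unfolding drive_def by measurable
  have law: "memory_law rate_law t = density (rate_law \<Otimes>\<^sub>M lborel) (\<lambda>p. ennreal (?g p))"
    by (simp add: memory_law_def case_prod_unfold)
  have incl: "?incl \<in> \<rho> \<Otimes>\<^sub>M lborel \<rightarrow>\<^sub>M borel \<Otimes>\<^sub>M borel"
  proof -
    have "(\<lambda>z. snd z) \<in> borel_measurable (\<rho> \<Otimes>\<^sub>M (lborel :: real measure))"
      by measurable
    from measurable_Pair[OF measurable_compose[OF measurable_fst rate_law(4)] this] show ?thesis
      by (simp only: case_prod_unfold)
  qed
  have prod: "rate_law \<Otimes>\<^sub>M lborel = distr (\<rho> \<Otimes>\<^sub>M lborel) (borel \<Otimes>\<^sub>M borel) ?incl"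
    using pair_measure_distr[of "\<lambda>R. R" \<rho> borel "\<lambda>s. s" lborel borel] rate_law(4)
    by (simp add: distr_id2 sigma_finite_lborel)
  have "drift A t \<omega> = (\<integral>p. ?g p * drive A p \<omega> \<partial>(rate_law \<Otimes>\<^sub>M lborel))"
    unfolding drift_def law by (subst integral_density) auto
  also have "\<dots> = (\<integral>z. ?g (?incl z) * drive A (?incl z) \<omega> \<partial>(\<rho> \<Otimes>\<^sub>M lborel))"
    unfolding prod by (rule integral_distr[OF incl]) measurable
  also have "\<dots> = (\<integral>(R, s). indicator (A \<inter> {0<..}) R * indicator {..t} s * exp (- R * (t - s)) *
      (R * (a + b * Q s \<omega>)) \<partial>(\<rho> \<Otimes>\<^sub>M lborel))"
    by (intro Bochner_Integration.integral_cong)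
       (auto simp: space_pair_measure rate_law(5) drive_def indicator_def)
  finally show ?thesis ..
qed

lemma drift_square_integrable:
  assumes "A \<in> sets borel"
  shows "square_integrable M (drift A t)"
  unfolding drift_def by (rule averaged_process.average_square_integrable[OF averaged_process_drive[OF assms]])

lemma expectation_drift:
  assumes [measurable]: "A \<in> sets borel"
  shows "expectation (drift A t) = (a + b * Qbar) * measure \<rho> (A \<inter> {0<..})"
proof -
  note [measurable_cong] = sets_law[of t]
  interpret D: averaged_process M "memory_law rate_law t" "drive A"
    by (rule averaged_process_drive) fact
  have "expectation (drive A p) = (a + b * Qbar) * indicator A (fst p)" for p
    by (simp add: drive_def[abs_def] prob_space Q_mean integrable_if_square_integrable[OF Q_square_integrable])
  then have "expectation (drift A t) = (a + b * Qbar) * (\<integral>p. indicator A (fst p) \<partial>memory_law rate_law t)"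
    unfolding drift_def D.expectation_average by simp
  also have "(\<integral>p. indicator A (fst p) \<partial>memory_law rate_law t) =
      enn2real (\<integral>\<^sup>+p. indicator A (fst p) \<partial>memory_law rate_law t)"
    by (subst integral_eq_nn_integral) (auto simp: ennreal_indicator)
  also have "\<dots> = enn2real (emeasure rate_law A)"
    by (simp add: nn_integral_memory_law_rate[OF rate_law(2,3), of "indicator A"])
  also have "\<dots> = measure \<rho> (A \<inter> {0<..})"
    using rate_law(4,5) by (simp add: emeasure_distr measure_def)
  finally show ?thesis .
qed

text \<open>The two averages are pulled out of the covariance one after the other.\<close>

lemma covariance_drift:
  assumes "0 \<le> h"
  shows "covariance M (drift UNIV t) (drift UNIV (t + h)) =
    b\<^sup>2 * Vbar * (I_integral \<rho> \<theta> h + J_integral \<rho> \<theta> h)"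
proof -
  interpret D: averaged_process M "memory_law rate_law t" "drive UNIV"
    by (rule averaged_process_drive) simp
  interpret D': averaged_process M "memory_law rate_law (t + h)" "drive UNIV"
    by (rule averaged_process_drive) simp
  have drive: "drive UNIV p = (\<lambda>\<omega>. a + b * Q (snd p) \<omega>)" for p
    by (simp add: drive_def fun_eq_iff)
  have sq: "square_integrable M (drive UNIV p)" for p
    unfolding drive by (intro square_integrable_add square_integrable_cmult square_integrable_const Q_square_integrable)
  have corr: "(\<integral>r. exp (- (r * c)) \<partial>\<theta>) = (\<integral>r. exp (- (r * c)) \<partial>correlation_law)" for c
    by (rule integral_distr[OF correlation_law(4), symmetric]) measurable
  have point: "covariance M (drive UNIV p) (drive UNIV q) =
      b\<^sup>2 * Vbar * (\<integral>r. exp (- (r * \<bar>snd p - snd q\<bar>)) \<partial>correlation_law)" for p q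
  proof -
    have "covariance M (drive UNIV p) (drive UNIV q) = b * covariance M (drive UNIV q) (Q (snd p))"
      unfolding drive[of p] covariance_affine_left[OF Q_square_integrable] by (simp add: covariance_commute)
    also have "\<dots> = b * (b * covariance M (Q (snd p)) (Q (snd q)))"
      unfolding drive[of q] covariance_affine_left[OF Q_square_integrable] by (simp add: covariance_commute)
    finally show ?thesis
      by (simp add: Q_covariance corr power2_eq_square)
  qed
  have "covariance M (drift UNIV t) (drift UNIV (t + h)) =
      (\<integral>p. covariance M (drift UNIV (t + h)) (drive UNIV p) \<partial>memory_law rate_law t)"
    unfolding drift_def[abs_def] by (subst covariance_commute) (rule D.covariance_average[OF D'.average_square_integrable])
  also have "\<dots> = (\<integral>p. \<integral>q. covariance M (drive UNIV p) (drive UNIV q)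
      \<partial>memory_law rate_law (t + h) \<partial>memory_law rate_law t)"
    unfolding drift_def[abs_def]
    by (intro Bochner_Integration.integral_cong refl) (subst covariance_commute, rule D'.covariance_average[OF sq])
  also have "\<dots> = b\<^sup>2 * Vbar * (\<integral>p. \<integral>q. \<integral>r. exp (- (r * \<bar>snd p - snd q\<bar>)) \<partial>correlation_law
      \<partial>memory_law rate_law (t + h) \<partial>memory_law rate_law t)"
    by (simp add: point)
  also have "\<dots> = b\<^sup>2 * Vbar * (I_integral \<rho> \<theta> h + J_integral \<rho> \<theta> h)"
    using memory_law_exp_correlation[OF rate_law(1-3) correlation_law(1-3) assms]
      I_J_integral_extend[OF prob_space_\<rho> sets_\<rho> prob_space_\<theta> sets_\<theta>]
    by simp
  finally show ?thesis .
qed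

lemma covariance_drift_if_uncorrelated:
  assumes Y: "square_integrable M Y" and uncorrelated: "\<And>s. covariance M Y (Q s) = 0"
  shows "covariance M Y (drift UNIV t) = 0"
proof -
  interpret D: averaged_process M "memory_law rate_law t" "drive UNIV"
    by (rule averaged_process_drive) simp
  have "covariance M Y (drive UNIV p) = 0" for p
    using covariance_affine_left[OF Q_square_integrable, of a b "snd p" Y] uncorrelated[of "snd p"]
    by (subst covariance_commute) (simp add: drive_def[abs_def] covariance_commute[of _ Y])
  then show ?thesis
    using D.covariance_average[OF Y] by (simp add: drift_def[abs_def])
qed

definition noise_kernel :: "real set \<Rightarrow> real \<Rightarrow> real \<times> real \<Rightarrow> real" where
  "noise_kernel A t = (\<lambda>(R, s). indicator A R * indicator {..t} s * exp (- R * (t - s)) * (\<sigma> * sqrt R))"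

lemma noise_kernel_measurable:
  assumes "A \<in> sets pos_borel"
  shows "noise_kernel A t \<in> borel_measurable (pos_borel \<Otimes>\<^sub>M borel)"
proof -
  have [measurable]: "A \<in> sets borel"
    using assms by (auto simp: sets_restrict_space_iff)
  have fst_borel: "(\<lambda>p. fst p) \<in> borel_measurable (pos_borel \<Otimes>\<^sub>M (borel :: real measure))"
    by (rule measurable_compose[OF measurable_fst]) (simp add: measurable_restrict_space1)
  have "noise_kernel A t \<in> borel_measurable (borel \<Otimes>\<^sub>M borel)"
    unfolding noise_kernel_def by measurable
  from measurable_compose[OF measurable_Pair[OF fst_borel measurable_snd] this] show ?thesis
    by simp
qed

lemma noise_kernel_mult_nonneg: "0 \<le> noise_kernel A t p * noise_kernel A u p"
proof -
  have "noise_kernel A t p * noise_kernel A u p =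
      (indicator A (fst p) * indicator {..t} (snd p) * exp (- fst p * (t - snd p))) *
      (indicator A (fst p) * indicator {..u} (snd p) * exp (- fst p * (u - snd p))) * (\<sigma> * sqrt (fst p))\<^sup>2"
    by (simp add: noise_kernel_def case_prod_unfold power2_eq_square mult_ac)
  then show ?thesis
    by simp
qed

text \<open>The product of the kernels at lag \<open>h\<close> is \<open>\<sigma>\<^sup>2 R exp (- 2 R x - R h)\<close> at age \<open>x\<close>; integrating over \<open>x\<close>
  cancels the factor \<open>R\<close>.\<close>

lemma noise_kernel_time_integral:
  assumes "0 < R" "0 \<le> h"
  shows "(\<integral>\<^sup>+s. ennreal (noise_kernel A t (R, s) * noise_kernel A (t + h) (R, s)) \<partial>lborel) =
    ennreal (indicator A R * (\<sigma>\<^sup>2 / 2 * exp (- R * h)))"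
proof -
  define c where "c = indicator A R * (\<sigma>\<^sup>2 * R * exp (- R * h))"
  have c: "0 \<le> c"
    using assms by (simp add: c_def)
  have "noise_kernel A t (R, t - x) * noise_kernel A (t + h) (R, t - x) =
      c * (indicator {0..} x * exp (- (2 * R * x)))" for x
  proof (cases "0 \<le> x")
    case True
    have "exp (- (R * x)) * exp (- (R * (h + x))) = exp (- (R * h)) * exp (- (2 * R * x))"
      by (simp add: exp_add[symmetric] algebra_simps)
    then show ?thesis
      using True assms
      by (simp add: noise_kernel_def c_def indicator_def power2_eq_square algebra_simps)
  qed (simp add: noise_kernel_def)
  then have "(\<integral>\<^sup>+s. ennreal (noise_kernel A t (R, s) * noise_kernel A (t + h) (R, s)) \<partial>lborel) =
      (\<integral>\<^sup>+x. ennreal (c * (indicator {0..} x * exp (- (2 * R * x)))) \<partial>lborel)"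
    by (subst nn_integral_real_affine[where c="-1" and t=t]) (simp_all add: noise_kernel_def)
  also have "\<dots> = ennreal c * ennreal (1 / (2 * R))"
    unfolding ennreal_mult'[OF c]
    using nn_integral_exp_decay[of "2 * R"] assms by (subst nn_integral_cmult) auto
  also have "\<dots> = ennreal (c * (1 / (2 * R)))"
    by (rule ennreal_mult'[OF c, symmetric])
  also have "c * (1 / (2 * R)) = indicator A R * (\<sigma>\<^sup>2 / 2 * exp (- R * h))"
    using assms by (simp add: c_def)
  finally show ?thesis .
qed

lemma m_measurable: "m t \<in> M \<rightarrow>\<^sub>M finite_measure_algebra pos_borel"
  using measurable_Pair2[OF m_jointly_measurable, of t] by simp

lemmas m_finite = finite_measure_kernel[OF m_measurable]

lemma space_m: "\<omega> \<in> space M \<Longrightarrow> space (m t \<omega>) = {0<..}"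
  using space_finite_kernel[OF m_measurable] by (simp add: space_restrict_space)

lemma emeasure_m_measurable: "A \<in> sets pos_borel \<Longrightarrow> (\<lambda>\<omega>. emeasure (m t \<omega>) A) \<in> borel_measurable M"
  by (rule measurable_compose[OF m_measurable measurable_emeasure_finite_measure_algebra])

lemma measure_m_measurable: "A \<in> sets pos_borel \<Longrightarrow> (\<lambda>\<omega>. measure (m t \<omega>) A) \<in> borel_measurable M"
  unfolding measure_def by (intro borel_measurable_enn2real emeasure_m_measurable)

lemma noise_space_time_integral:
  assumes A: "A \<in> sets pos_borel" and "0 \<le> h"
  shows "(\<integral>\<^sup>+\<omega>. \<integral>\<^sup>+s. \<integral>\<^sup>+R. ennreal (noise_kernel A u (R, s) * noise_kernel A (u + h) (R, s)) \<partial>m s \<omega> \<partial>lborel \<partial>M) =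
    (\<integral>\<^sup>+\<omega>. \<integral>\<^sup>+R. ennreal (indicator A R * (\<sigma>\<^sup>2 / 2 * exp (- R * h))) \<partial>m t \<omega> \<partial>M)"
proof -
  have "(\<integral>\<^sup>+\<omega>. \<integral>\<^sup>+s. \<integral>\<^sup>+R. ennreal (noise_kernel A u (R, s) * noise_kernel A (u + h) (R, s)) \<partial>m s \<omega> \<partial>lborel \<partial>M) =
    (\<integral>\<^sup>+\<omega>. \<integral>\<^sup>+R. \<integral>\<^sup>+s. ennreal (noise_kernel A u (R, s) * noise_kernel A (u + h) (R, s)) \<partial>lborel \<partial>m t \<omega> \<partial>M)"
    using noise_kernel_measurable[OF A]
    by (intro nn_integral_space_time_stationary[OF prob_space_axioms m_stationary m_jointly_measurable]) measurable
  also have "\<dots> = (\<integral>\<^sup>+\<omega>. \<integral>\<^sup>+R. ennreal (indicator A R * (\<sigma>\<^sup>2 / 2 * exp (- R * h))) \<partial>m t \<omega> \<partial>M)"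
    using assms(2) by (intro nn_integral_cong) (simp add: noise_kernel_time_integral space_m)
  finally show ?thesis .
qed

end

text \<open>The time \<open>t\<close> fixes the representative \<open>m t\<close> of the stationary law; expectations of integrals over
  all times are reduced to it.\<close>

locale square_integrable_memory = memory_process +
  fixes t :: real
  assumes memory_square_integrable: "square_integrable M (memory m t)"
begin

lemma expected_mass_finite: "(\<integral>\<^sup>+\<omega>. emeasure (m t \<omega>) {0<..} \<partial>M) < \<infinity>"
proof -
  have "(\<integral>\<^sup>+\<omega>. emeasure (m t \<omega>) {0<..} \<partial>M) = (\<integral>\<^sup>+\<omega>. ennreal (memory m t \<omega>) \<partial>M)"
    by (intro nn_integral_cong) (simp add: memory_def finite_measure.emeasure_eq_measure[OF m_finite])
  also have "\<dots> < \<infinity>"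
    using integrable_if_square_integrable[OF memory_square_integrable]
    by (subst nn_integral_eq_integral) (auto simp: memory_def)
  finally show ?thesis .
qed

lemma noise_covariation_finite:
  assumes "A \<in> sets pos_borel" "0 \<le> h"
  shows "(\<integral>\<^sup>+\<omega>. \<integral>\<^sup>+s. \<integral>\<^sup>+R. ennreal (noise_kernel A u (R, s) * noise_kernel A (u + h) (R, s)) \<partial>m s \<omega> \<partial>lborel \<partial>M) < \<infinity>"
proof -
  have "(\<integral>\<^sup>+\<omega>. \<integral>\<^sup>+R. ennreal (indicator A R * (\<sigma>\<^sup>2 / 2 * exp (- R * h))) \<partial>m t \<omega> \<partial>M) \<le>
      (\<integral>\<^sup>+\<omega>. ennreal (\<sigma>\<^sup>2 / 2) * emeasure (m t \<omega>) {0<..} \<partial>M)"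
  proof (rule nn_integral_mono)
    fix \<omega> assume \<omega>: "\<omega> \<in> space M"
    have "(\<integral>\<^sup>+R. ennreal (indicator A R * (\<sigma>\<^sup>2 / 2 * exp (- R * h))) \<partial>m t \<omega>) \<le> (\<integral>\<^sup>+R. ennreal (\<sigma>\<^sup>2 / 2) \<partial>m t \<omega>)"
      using \<omega> assms(2)
      by (intro nn_integral_mono ennreal_leI) (auto simp: space_m indicator_def mult_left_le)
    then show "(\<integral>\<^sup>+R. ennreal (indicator A R * (\<sigma>\<^sup>2 / 2 * exp (- R * h))) \<partial>m t \<omega>) \<le>
        ennreal (\<sigma>\<^sup>2 / 2) * emeasure (m t \<omega>) {0<..}"
      using \<omega> by (simp add: space_m)
  qed
  also have "\<dots> = ennreal (\<sigma>\<^sup>2 / 2) * (\<integral>\<^sup>+\<omega>. emeasure (m t \<omega>) {0<..} \<partial>M)"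
    by (rule nn_integral_cmult) (rule emeasure_m_measurable, simp add: sets_restrict_space_iff)
  also have "\<dots> < \<infinity>"
    using expected_mass_finite by (simp add: ennreal_mult_less_top)
  finally show ?thesis
    unfolding noise_space_time_integral[OF assms, of u t] .
qed

text \<open>Admissibility is the case of lag zero.\<close>

lemma admissible_noise_kernel:
  assumes "A \<in> sets pos_borel"
  shows "admissible M m (noise_kernel A u)"
  using noise_kernel_measurable[OF assms] noise_covariation_finite[OF assms order_refl, of u]
  by (simp add: admissible_def power2_eq_square)

lemma noise_square_integrable:
  assumes "A \<in> sets pos_borel"
  shows "square_integrable M (B (noise_kernel A u))"
  using B_measurable B_square_integrable admissible_noise_kernel[OF assms] by (simp add: square_integrable_def)

lemma m_decomposition:
  assumes A: "A \<in> sets pos_borel"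
  shows "AE \<omega> in M. measure (m u \<omega>) A = drift A u \<omega> + B (noise_kernel A u) \<omega>"
proof -
  have A': "A \<in> sets borel" "A \<inter> {0<..} = A"
    using A by (auto simp: sets_restrict_space_iff)
  show ?thesis
    using m_equation[OF A, of u] AE_space
    by eventually_elim (use drift_eq[OF A'(1), of _ u] in \<open>simp add: A'(2) noise_kernel_def\<close>)
qed

text \<open>The noise integral has mean zero, so only the mean of the drift remains.\<close>

lemma expectation_m:
  assumes A: "A \<in> sets pos_borel"
  shows "expectation (\<lambda>\<omega>. measure (m u \<omega>) A) = (a + b * Qbar) * measure \<rho> A"
    and "square_integrable M (\<lambda>\<omega>. measure (m u \<omega>) A)"
proof -
  have A': "A \<in> sets borel" "A \<inter> {0<..} = A"
    using A by (auto simp: sets_restrict_space_iff)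
  note sq = drift_square_integrable[OF A'(1), of u] noise_square_integrable[OF A, of u]
  note meas = measure_m_measurable[OF A, of u] square_integrable_measurable[OF square_integrable_add[OF sq]]
  have "expectation (\<lambda>\<omega>. measure (m u \<omega>) A) = expectation (\<lambda>\<omega>. drift A u \<omega> + B (noise_kernel A u) \<omega>)"
    using m_decomposition[OF A] meas by (intro integral_cong_AE) auto
  also have "\<dots> = (a + b * Qbar) * measure \<rho> A"
    using sq[THEN integrable_if_square_integrable] B_mean[OF admissible_noise_kernel[OF A]]
    by (simp add: expectation_drift[OF A'(1)] A'(2))
  finally show "expectation (\<lambda>\<omega>. measure (m u \<omega>) A) = (a + b * Qbar) * measure \<rho> A" .
  have "integrable M (\<lambda>\<omega>. (measure (m u \<omega>) A)\<^sup>2) \<longleftrightarrow>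
      integrable M (\<lambda>\<omega>. (drift A u \<omega> + B (noise_kernel A u) \<omega>)\<^sup>2)"
    using m_decomposition[OF A, of u] meas by (intro integrable_cong_AE) (auto elim!: eventually_mono)
  then show "square_integrable M (\<lambda>\<omega>. measure (m u \<omega>) A)"
    using square_integrable_add[OF sq] meas by (simp add: square_integrable_def)
qed

lemma emeasure_intensity:
  assumes A: "A \<in> sets pos_borel"
  shows "(\<integral>\<^sup>+\<omega>. emeasure (m u \<omega>) A \<partial>M) = ennreal (a + b * Qbar) * emeasure \<rho> A"
proof -
  interpret \<rho>: prob_space \<rho> by (rule prob_space_\<rho>)
  have "(\<integral>\<^sup>+\<omega>. emeasure (m u \<omega>) A \<partial>M) = (\<integral>\<^sup>+\<omega>. ennreal (measure (m u \<omega>) A) \<partial>M)"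
    by (intro nn_integral_cong) (simp add: finite_measure.emeasure_eq_measure[OF m_finite])
  also have "\<dots> = ennreal ((a + b * Qbar) * measure \<rho> A)"
    using expectation_m[OF A, of u] by (simp add: nn_integral_eq_integral integrable_if_square_integrable)
  finally show ?thesis
    using a_nonneg b_nonneg Qbar_pos by (simp add: \<rho>.emeasure_eq_measure ennreal_mult)
qed

text \<open>The isometry, evaluated with the intensity \<open>(a + b Qbar) \<rho>\<close>.\<close>

lemma expectation_noise_mult:
  assumes "0 \<le> h"
  shows "expectation (\<lambda>\<omega>. B (noise_kernel {0<..} u) \<omega> * B (noise_kernel {0<..} (u + h)) \<omega>) =
    \<sigma>\<^sup>2 / 2 * (a + b * Qbar) * (\<integral>R. exp (- R * h) \<partial>\<rho>)"
proof -
  have pos: "{0<..} \<in> sets pos_borel"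
    by (simp add: sets_restrict_space_iff)
  let ?f = "\<lambda>p. noise_kernel {0<..} u p * noise_kernel {0<..} (u + h) p"
  let ?g = "\<lambda>R. \<sigma>\<^sup>2 / 2 * exp (- R * h)"
  have g_meas: "(\<lambda>R. ?g R) \<in> borel_measurable pos_borel"
    by (rule measurable_restrict_space1) measurable
  have g_meas_\<rho>: "(\<lambda>R. ?g R) \<in> borel_measurable \<rho>"
    using g_meas by (simp add: measurable_cong_sets[OF sets_\<rho> refl])
  have c: "0 \<le> a + b * Qbar"
    using a_nonneg b_nonneg Qbar_pos by simp
  have "expectation (\<lambda>\<omega>. B (noise_kernel {0<..} u) \<omega> * B (noise_kernel {0<..} (u + h)) \<omega>) =
      (\<integral>\<omega>. \<integral>s. \<integral>R. ?f (R, s) \<partial>m s \<omega> \<partial>lborel \<partial>M)"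
    by (intro B_isometry admissible_noise_kernel pos)
  also have "\<dots> = enn2real (\<integral>\<^sup>+\<omega>. \<integral>\<^sup>+s. \<integral>\<^sup>+R. ennreal (?f (R, s)) \<partial>m s \<omega> \<partial>lborel \<partial>M)"
    using noise_kernel_measurable[OF pos] noise_covariation_finite[OF pos assms]
    by (intro integral_space_time_kernel[OF m_jointly_measurable] noise_kernel_mult_nonneg) auto
  also have "\<dots> = enn2real (\<integral>\<^sup>+\<omega>. \<integral>\<^sup>+R. ennreal (indicator {0<..} R * ?g R) \<partial>m t \<omega> \<partial>M)"
    using noise_space_time_integral[OF pos assms, of u t] by simp
  also have "(\<integral>\<^sup>+\<omega>. \<integral>\<^sup>+R. ennreal (indicator {0<..} R * ?g R) \<partial>m t \<omega> \<partial>M) = (\<integral>\<^sup>+\<omega>. \<integral>\<^sup>+R. ennreal (?g R) \<partial>m t \<omega> \<partial>M)"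
    by (intro nn_integral_cong) (simp add: space_m)
  also have "\<dots> = ennreal (a + b * Qbar) * (\<integral>\<^sup>+R. ennreal (?g R) \<partial>\<rho>)"
    using g_meas by (intro nn_integral_intensity[OF m_measurable sets_\<rho>] emeasure_intensity) auto
  also have "enn2real \<dots> = (a + b * Qbar) * (\<integral>R. ?g R \<partial>\<rho>)"
  proof -
    have "enn2real (\<integral>\<^sup>+R. ennreal (?g R) \<partial>\<rho>) = (\<integral>R. ?g R \<partial>\<rho>)"
      by (rule integral_eq_nn_integral[symmetric]) (use g_meas_\<rho> in auto)
    then show ?thesis
      using c by (simp only: enn2real_mult enn2real_ennreal)
  qed
  finally show ?thesis
    by simp
qed

text \<open>Of the four covariances between drifts and noise integrals the two mixed ones vanish.\<close>

lemma covariance_memory: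
  assumes h: "0 \<le> h"
  shows "covariance M (memory m u) (memory m (u + h)) =
    \<sigma>\<^sup>2 / 2 * expectation (memory m u) * (\<integral>R. exp (- R * h) \<partial>\<rho>) +
    b\<^sup>2 * Vbar * (I_integral \<rho> \<theta> h + J_integral \<rho> \<theta> h)"
proof -
  have pos: "{0<..} \<in> sets pos_borel"
    by (simp add: sets_restrict_space_iff)
  let ?X = "drift UNIV" and ?Y = "\<lambda>v. B (noise_kernel {0<..} v)"
  note X = drift_square_integrable[of UNIV] and Y = noise_square_integrable[OF pos]
  have X_sq: "square_integrable M (?X v)" for v
    by (rule X) simp
  have drift_UNIV: "AE \<omega> in M. drift {0<..} v \<omega> = ?X v \<omega>" for v
    using AE_space by eventually_elim (simp flip: drift_eq)
  have decomposition: "AE \<omega> in M. memory m v \<omega> = ?X v \<omega> + ?Y v \<omega>" for v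
    using m_decomposition[OF pos, of v] drift_UNIV[of v] by eventually_elim (simp add: memory_def)
  (* The noise is uncorrelated with each discharge value, hence with the averages of these values. *)
  have YX: "covariance M (?Y v) (?X w) = 0" for v w
  proof (rule covariance_drift_if_uncorrelated[OF Y])
    fix s
    have "Q s \<in> borel_measurable (generated_algebra M Q)"
      unfolding generated_algebra_def by (rule measurable_SUP1[of s]) (auto intro!: measurable_vimage_algebra1)
    then show "covariance M (?Y v) (Q s) = 0"
      using Q_square_integrable[of s]
      by (intro B_uncorrelated admissible_noise_kernel pos) (auto simp: square_integrable_def)
  qed
  have mean: "expectation (memory m u) = a + b * Qbar"
    using expectation_m(1)[OF pos, of u] prob_space.prob_space[OF prob_space_\<rho>] rate_law(5)
    by (simp add: memory_def[abs_def])
  have "covariance M (memory m u) (memory m (u + h)) =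
      covariance M (\<lambda>\<omega>. ?X u \<omega> + ?Y u \<omega>) (\<lambda>\<omega>. ?X (u + h) \<omega> + ?Y (u + h) \<omega>)"
    by (intro covariance_cong_AE decomposition square_integrable_measurable square_integrable_add X_sq Y)
       (simp_all add: memory_def[abs_def] expectation_m(2) pos)
  also have "\<dots> = covariance M (?X (u + h)) (?X u) + covariance M (?Y (u + h)) (?X u) +
      (covariance M (?X (u + h)) (?Y u) + covariance M (?Y (u + h)) (?Y u))"
  proof -
    note add = square_integrable_add[OF X_sq Y]
    have "covariance M (\<lambda>\<omega>. ?X u \<omega> + ?Y u \<omega>) (\<lambda>\<omega>. ?X (u + h) \<omega> + ?Y (u + h) \<omega>) =
        covariance M (\<lambda>\<omega>. ?X (u + h) \<omega> + ?Y (u + h) \<omega>) (?X u) +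
        covariance M (\<lambda>\<omega>. ?X (u + h) \<omega> + ?Y (u + h) \<omega>) (?Y u)"
      using covariance_add_left[OF X_sq Y add, of u u "u + h" "u + h"]
      by (simp only: covariance_commute[of "\<lambda>\<omega>. ?X (u + h) \<omega> + ?Y (u + h) \<omega>"])
    then show ?thesis
      by (simp only: covariance_add_left[OF X_sq Y X_sq] covariance_add_left[OF X_sq Y Y])
  qed
  also have "\<dots> = covariance M (?X u) (?X (u + h)) + covariance M (?Y u) (?Y (u + h))"
    using YX covariance_commute[of "?X (u + h)" "?Y u"] covariance_commute[of "?X (u + h)" "?X u"]
      covariance_commute[of "?Y (u + h)" "?Y u"]
    by simp
  also have "covariance M (?Y u) (?Y (u + h)) = \<sigma>\<^sup>2 / 2 * expectation (memory m u) * (\<integral>R. exp (- R * h) \<partial>\<rho>)"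
    using expectation_noise_mult[OF h, of u] B_mean[OF admissible_noise_kernel[OF pos]]
    by (simp add: covariance_eq[OF Y Y] mean)
  finally show ?thesis
    by (simp add: covariance_drift[OF h])
qed

end


theorem proposition2:
  fixes M :: "'w measure" and F :: "real \<Rightarrow> 'w measure"
    and Q :: "real \<Rightarrow> 'w \<Rightarrow> real" and \<theta> \<rho> :: "real measure"
    and Qbar Vbar a b \<sigma> t h :: real
    and m :: "real \<Rightarrow> 'w \<Rightarrow> real measure"
    and B :: "(real \<times> real \<Rightarrow> real) \<Rightarrow> 'w \<Rightarrow> real"
  assumes "memory_process M F Q \<theta> Qbar Vbar a b \<sigma> \<rho> m B"
    and "0 < prob_space.variance M (memory m t)"
    and "0 \<le> h"
  shows "autocorrelation M (memory m) t h =
    1 / prob_space.variance M (memory m t) *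
      (\<sigma>\<^sup>2 / 2 * prob_space.expectation M (memory m t) * (\<integral>R. exp (- R * h) \<partial>\<rho>)
       + b\<^sup>2 * Vbar * (I_integral \<rho> \<theta> h + J_integral \<rho> \<theta> h))"
proof -
  interpret memory_process M F Q \<theta> Qbar Vbar a b \<sigma> \<rho> m B by fact
  have "memory m t \<in> borel_measurable M"
    unfolding memory_def[abs_def] by (rule measure_m_measurable) (simp add: sets_restrict_space_iff)
  then have "square_integrable M (memory m t)"
    using assms(2) by (rule square_integrable_if_variance_pos)
  then interpret square_integrable_memory M F Q \<theta> Qbar Vbar a b \<sigma> \<rho> m B t
    by unfold_locales
  show ?thesis
    using covariance_memory[OF assms(3), of t] by (simp add: autocorrelation_def)
qed

end
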